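(* Let $F : \mathbb{C}^n \to \mathbb{C}^m$ be a polynomial map of degree $d$ and let $\lambda_1, \lambda_2, \ldots, \lambda_{d-1} \in \mathbb{C}$ be such that $\sum_{i \in I} \lambda_i \neq 0$ for all nonempty $I \subseteq \{1,2,\ldots,d-1\}$. If $$\operatorname{rk}\Big(\sum_{i=1}^{d-1} \lambda_i\, (\mathcal{J}F)|_{X=\alpha_i}\Big) = n$$ for all $\alpha_1, \ldots, \alpha_{d-1} \in \mathbb{C}^n$, then $F$ is injective. If additionally $n = m$, then $F$ is an invertible polynomial map.
   Context: $\mathcal{J}F$ denotes the Jacobian matrix of the polynomial map $F=(F_1,\ldots,F_m)$ with respect to the coordinates $X=(X_1,\ldots,X_n)$ (an $m\times n$ matrix of polynomials), and $(\mathcal{J}F)|_{X=\alpha}$ is its evaluation at $\alpha \in \mathbb{C}^n$. The degree of $F$ is the maximum of the degrees of its components. A polynomial map $\mathbb{C}^n\to\mathbb{C}^n$ is invertible if it has an inverse that is a polynomial map. Empty sums are zero. *)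

theory Defs
  imports "HOL-Analysis.Analysis" "HOL-Library.Poly_Mapping"
begin

text \<open>Polynomials over the complex numbers in variables indexed by \<open>'n\<close>: the convolution ring of
  finitely supported functions from exponent vectors to coefficients.\<close>
type_synonym 'n cpoly = "('n \<Rightarrow>\<^sub>0 nat) \<Rightarrow>\<^sub>0 complex"

definition poly_eval :: "'n::finite cpoly \<Rightarrow> complex^'n \<Rightarrow> complex" where
  "poly_eval p x =
     (\<Sum>e\<in>Poly_Mapping.keys p.
        Poly_Mapping.lookup p e * (\<Prod>i\<in>UNIV. (x $ i) ^ Poly_Mapping.lookup e i))"

text \<open>The zero polynomial gets degree 0.\<close>
definition total_degree :: "'n::finite cpoly \<Rightarrow> nat" where
  "total_degree p =
     Max (insert 0 ((\<lambda>e. \<Sum>i\<in>UNIV. Poly_Mapping.lookup e i) ` Poly_Mapping.keys p))"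

text \<open>Subtraction of exponent vectors is truncated, but a term free of \<open>X\<^sub>i\<close> gets coefficient 0.\<close>
definition partial_deriv :: "'n::finite \<Rightarrow> 'n cpoly \<Rightarrow> 'n cpoly" where
  "partial_deriv i p =
     (\<Sum>e\<in>Poly_Mapping.keys p.
        Poly_Mapping.single (e - Poly_Mapping.single i 1)
          (of_nat (Poly_Mapping.lookup e i) * Poly_Mapping.lookup p e))"

text \<open>A polynomial map in \<open>'n\<close>-indexed coordinates with \<open>'m\<close>-indexed components is a vector of
  polynomials; \<open>polymap_fun F\<close> is the function it induces.\<close>
type_synonym ('n, 'm) polymap = "('n cpoly, 'm) vec"

definition polymap_fun :: "('n::finite, 'm::finite) polymap \<Rightarrow> complex^'n \<Rightarrow> complex^'m" where
  "polymap_fun F x = (\<chi> j. poly_eval (F $ j) x)"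

definition polymap_degree :: "('n::finite, 'm::finite) polymap \<Rightarrow> nat" where
  "polymap_degree F = Max (range (\<lambda>j. total_degree (F $ j)))"

text \<open>\<open>A ^ 'n ^ 'm\<close> is the type of matrices with rows indexed by \<open>'m\<close> and columns by \<open>'n\<close>.\<close>
definition jacobian_matrix :: "('n::finite, 'm::finite) polymap \<Rightarrow> 'n cpoly ^ 'n ^ 'm" where
  "jacobian_matrix F = (\<chi> j k. partial_deriv k (F $ j))"

definition eval_matrix :: "'n::finite cpoly ^ 'k ^ 'm \<Rightarrow> complex^'n \<Rightarrow> complex ^ 'k ^ 'm" where
  "eval_matrix A x = (\<chi> j k. poly_eval (A $ j $ k) x)"

text \<open>The library only scales complex matrices by reals.\<close>
definition smult_matrix :: "complex \<Rightarrow> complex ^ 'n ^ 'm \<Rightarrow> complex ^ 'n ^ 'm" where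
  "smult_matrix c A = (\<chi> j k. c * A $ j $ k)"

definition invertible_polymap :: "('n::finite, 'm::finite) polymap \<Rightarrow> bool" where
  "invertible_polymap F \<longleftrightarrow>
     (\<exists>G :: ('m, 'n) polymap.
        (\<forall>x. polymap_fun G (polymap_fun F x) = x) \<and> (\<forall>y. polymap_fun F (polymap_fun G y) = y))"

end

theory Submission
  imports Defs "HOL-Computational_Algebra.Polynomial_Factorial" "HOL-Computational_Algebra.Field_as_Ring"
    "HOL-Computational_Algebra.Fundamental_Theorem_Algebra"
begin

text \<open>
Let \<open>N = d - 1\<close> and let \<open>L\<close> be the sum of the weights \<open>lam i\<close>. On the line through \<open>a\<close> and \<open>b\<close> each
component of \<open>F\<close> is a polynomial \<open>P\<close> in one variable of degree at most \<open>N + 1\<close>, and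
\<open>P 1 - P 0\<close> is the integral of its derivative over the unit interval. There are nodes \<open>t i\<close>, depending
only on the weights, for which the quadrature rule with weights \<open>lam i / L\<close> computes this integral exactly
(\<open>quadrature_nodes\<close>). Therefore \<open>L *s (F b - F a) = M a b *v (b - a)\<close>, where \<open>M a b\<close> is the sum of
the Jacobian matrices at the points \<open>a + t i *s (b - a)\<close> with weights \<open>lam i\<close>
(\<open>node_matrix_difference\<close>). The rank hypothesis says that \<open>M a b\<close> has trivial kernel, and \<open>F\<close> is injective.

The nodes solve \<open>\<Sum>i. lam i * t i ^ k = L / (k + 1)\<close> for \<open>1 \<le> k \<le> N\<close>, and such systems are solvable for every
right-hand side (\<open>subset_sums_nonzero_imp_power_sums_surj\<close>). The hypothesis on the sums of weights means
that the homogeneous system has only the zero solution, so the map given by the power sums is proper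
and some \<open>t\<close> comes closest to the right-hand side. If it missed it, a perturbation of \<open>t\<close> would come
closer; where several \<open>t i\<close> coincide, this perturbation is of higher order and is built from solutions
with fewer nodes.

For \<open>n = m\<close> the determinant of \<open>M a b\<close> is a polynomial in \<open>a\<close> and \<open>b\<close> without zeros, hence a nonzero
constant, and Cramer's rule yields \<open>x i - y i = (\<Sum>j. (F j x - F j y) * N j x y)\<close> with polynomials \<open>N j\<close>. This
identity forces every coordinate \<open>x i\<close> to be a rational function of \<open>F x\<close> (\<open>coordinate_rational_over\<close>):
a linear functional over the rational functions of \<open>F\<close> that is 0 on 1 and 1 on \<open>x i\<close>, applied in the variable
\<open>x\<close>, would kill the right-hand side after setting \<open>x = y\<close>, but not the left-hand side. Finally, a rational
function \<open>l / h\<close> of \<open>F\<close> in lowest terms that is equal to a coordinate is a polynomial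
(\<open>rational_coordinate_is_polynomial\<close>). Indeed \<open>h\<close> has no zero on the image of \<open>F\<close>: the image is open by
invariance of domain, so with one zero of \<open>h\<close> it contains an open piece of the hypersurface \<open>h = 0\<close>, on
which \<open>l\<close> vanishes as well, contrary to coprimality. Hence \<open>h\<close> composed with \<open>F\<close> is a polynomial without
zeros, thus constant, and so is \<open>h\<close>. The polynomial left inverse found in this way is a right inverse on
the open image, and therefore everywhere.\<close>

section \<open>Weighted power sums and quadrature\<close>

definition subset_sums_nonzero :: "('i \<Rightarrow> complex) \<Rightarrow> 'i set \<Rightarrow> bool" where
  "subset_sums_nonzero lam I \<longleftrightarrow> (\<forall>J. J \<subseteq> I \<longrightarrow> J \<noteq> {} \<longrightarrow> sum lam J \<noteq> 0)"

definition power_sum :: "('i \<Rightarrow> complex) \<Rightarrow> 'i set \<Rightarrow> nat \<Rightarrow> ('i \<Rightarrow> complex) \<Rightarrow> complex" where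
  "power_sum lam I k t = (\<Sum>i\<in>I. lam i * t i ^ k)"

lemma subset_sums_nonzero_mono:
  "subset_sums_nonzero lam I \<Longrightarrow> J \<subseteq> I \<Longrightarrow> subset_sums_nonzero lam J"
  unfolding subset_sums_nonzero_def by blast

text \<open>Equal values of \<open>t\<close> are merged: a value \<open>a\<close> then carries as weight the sum of \<open>lam\<close> over a nonempty
set of indices, which is nonzero. The weighted sum of the values of any polynomial without constant
term of degree at most \<open>card I\<close> is 0, and some such polynomial singles out one nonzero value.\<close>

lemma power_sums_zero_imp_zero:
  assumes fin: "finite I" and nz: "subset_sums_nonzero lam I"
    and ps: "\<And>k. 1 \<le> k \<Longrightarrow> k \<le> card I \<Longrightarrow> power_sum lam I k t = 0"
    and i: "i \<in> I"
  shows "t i = 0"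
proof (rule ccontr)
  assume ti: "t i \<noteq> 0"
  define T where "T = t ` I - {0, t i}"
  define f where "f = [:0, 1:] * (\<Prod>a\<in>T. [:-a, 1:])"
  have finT: "finite T" using fin by (simp add: T_def)
  have degf: "degree f = Suc (card T)"
  proof -
    have "degree (\<Prod>a\<in>T. [:-a, 1:]) = (\<Sum>a\<in>T. degree [:-a, 1:])"
      by (rule degree_prod_eq_sum_degree) simp
    moreover have "(\<Prod>a\<in>T. [:-a, 1:]) \<noteq> 0"
      using finT by simp
    ultimately show ?thesis
      unfolding f_def by (subst degree_mult_eq) simp_all
  qed
  have "insert (t i) T \<subseteq> t ` I" using i by (auto simp: T_def)
  hence "card (insert (t i) T) \<le> card I"
    using card_mono[of "t ` I" "insert (t i) T"] card_image_le[OF fin, of t] fin by simp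
  hence degN: "degree f \<le> card I"
    using finT degf by (simp add: T_def)
  have f0: "coeff f 0 = 0" by (simp add: f_def)
  have "(\<Sum>j\<in>I. lam j * poly f (t j)) = (\<Sum>k\<le>degree f. coeff f k * power_sum lam I k t)"
    unfolding power_sum_def poly_altdef sum_distrib_left
    by (subst sum.swap) (simp add: algebra_simps)
  also have "\<dots> = 0"
  proof (rule sum.neutral, safe)
    fix k assume "k \<le> degree f"
    thus "coeff f k * power_sum lam I k t = 0"
      using f0 degN ps[of k] by (cases "k = 0") auto
  qed
  finally have 1: "(\<Sum>j\<in>I. lam j * poly f (t j)) = 0" .
  have pf: "poly f (t j) = (if t j = t i then poly f (t i) else 0)" if "j \<in> I" for j
    using that finT by (auto simp: f_def T_def poly_prod)
  have "(\<Sum>j\<in>I. lam j * poly f (t j)) = (\<Sum>j\<in>{j\<in>I. t j = t i}. lam j * poly f (t i))"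
    using fin by (intro sum.mono_neutral_cong_right) (auto simp: pf)
  also have "\<dots> = sum lam {j\<in>I. t j = t i} * poly f (t i)"
    by (simp add: sum_distrib_right)
  finally have "sum lam {j\<in>I. t j = t i} * poly f (t i) = 0" using 1 by simp
  moreover have "poly f (t i) \<noteq> 0"
    using ti finT by (auto simp: f_def poly_prod T_def)
  moreover have "sum lam {j\<in>I. t j = t i} \<noteq> 0"
    using nz[unfolded subset_sums_nonzero_def, rule_format, of "{j\<in>I. t j = t i}"] i by auto
  ultimately show False by simp
qed

text \<open>Coordinates outside \<open>I\<close> are pinned to 0, so that the set is compact in the product topology
whatever the index type.\<close>

definition polydisc :: "'i set \<Rightarrow> real \<Rightarrow> ('i \<Rightarrow> complex) set" where
  "polydisc I R = (\<Pi>\<^sub>E i\<in>UNIV. if i \<in> I then cball 0 R else {0})"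

lemma compact_polydisc: "compact (polydisc I R)"
proof -
  have "compactin (product_topology (\<lambda>i. euclidean) UNIV) (polydisc I R)"
    unfolding polydisc_def by (subst compactin_PiE) auto
  thus ?thesis by (simp add: euclidean_product_topology)
qed

lemma mem_polydisc: "t \<in> polydisc I R \<longleftrightarrow> (\<forall>i\<in>I. norm (t i) \<le> R) \<and> (\<forall>i. i \<notin> I \<longrightarrow> t i = 0)"
  unfolding polydisc_def by (auto simp: PiE_iff split: if_splits)

lemma continuous_on_power_sum [continuous_intros]:
  "continuous_on S (\<lambda>t. power_sum lam I k t)"
  unfolding power_sum_def
  by (intro continuous_intros continuous_on_subset[OF continuous_on_product_coordinates]) auto

lemma power_sum_restrict: "power_sum lam I k (\<lambda>i. if i \<in> I then t i else s i) = power_sum lam I k t"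
  unfolding power_sum_def by (intro sum.cong) auto

lemma power_sum_scale: "power_sum lam I k (\<lambda>i. r * t i) = r ^ k * power_sum lam I k t"
  unfolding power_sum_def by (simp add: power_mult_distrib sum_distrib_left mult_ac)

text \<open>Since the power sums have no common zero on the unit sphere, their total size there is bounded below
by some \<open>m > 0\<close>; homogeneity spreads this to a lower bound \<open>m * r\<close> on the sphere of radius \<open>r \<ge> 1\<close>.\<close>

lemma power_sums_proper:
  assumes fin: "finite I" and nz: "subset_sums_nonzero lam I"
  shows "\<exists>R. \<forall>t. (\<forall>k\<in>{1..card I}. norm (power_sum lam I k t) \<le> B) \<longrightarrow> (\<forall>i\<in>I. norm (t i) \<le> R)"
proof (cases "I = {}")
  case False
  define S where "S = polydisc I 1 \<inter> (\<Union>i\<in>I. {t. norm (t i) = 1})"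
  define G where "G t = (\<Sum>k\<in>{1..card I}. norm (power_sum lam I k t))" for t
  have "closed {t :: 'a \<Rightarrow> complex. norm (t i) = 1}" for i
    by (intro closed_Collect_eq continuous_intros continuous_on_product_coordinates)
  hence cS: "compact S" unfolding S_def
    by (intro compact_Int_closed compact_polydisc closed_UN fin) auto
  obtain i0 where i0: "i0 \<in> I" using False by blast
  have "(\<lambda>i. if i = i0 then 1 else 0) \<in> S"
    using i0 by (auto simp: S_def mem_polydisc)
  hence "S \<noteq> {}" by blast
  moreover have "continuous_on S G" unfolding G_def by (intro continuous_intros)
  ultimately obtain t0 where t0: "t0 \<in> S" "\<And>t. t \<in> S \<Longrightarrow> G t0 \<le> G t"
    using continuous_attains_inf[OF cS] by blast
  have G0: "G t0 > 0"
  proof (rule ccontr)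
    assume "\<not> ?thesis"
    moreover have "G t0 \<ge> 0" unfolding G_def by (intro sum_nonneg) auto
    ultimately have "G t0 = 0" by simp
    hence "power_sum lam I k t0 = 0" if "1 \<le> k" "k \<le> card I" for k
      using that unfolding G_def by (subst (asm) sum_nonneg_eq_0_iff) auto
    hence "\<And>i. i \<in> I \<Longrightarrow> t0 i = 0" using power_sums_zero_imp_zero[OF fin nz] by blast
    thus False using t0(1) by (auto simp: S_def)
  qed
  show ?thesis
  proof (intro exI allI impI)
    fix t assume t: "\<forall>k\<in>{1..card I}. norm (power_sum lam I k t) \<le> B"
    define r where "r = Max ((\<lambda>i. norm (t i)) ` I)"
    have rge: "norm (t i) \<le> r" if "i \<in> I" for i using that fin by (auto simp: r_def)
    have "r \<in> (\<lambda>i. norm (t i)) ` I" unfolding r_def using False fin by (intro Max_in) auto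
    then obtain i1 where i1: "i1 \<in> I" "r = norm (t i1)" by auto
    have "r \<le> max 1 (card I * B / G t0)"
    proof (cases "r \<ge> 1")
      case True
      define u where "u i = (if i \<in> I then inverse (of_real r) * t i else 0)" for i
      have pu: "power_sum lam I k u = inverse (of_real r) ^ k * power_sum lam I k t" for k
        unfolding u_def power_sum_restrict power_sum_scale by simp
      have "u \<in> S" using True i1 rge
        by (auto simp: S_def mem_polydisc u_def norm_mult norm_inverse norm_divide divide_simps intro!: bexI[of _ i1])
      hence "G t0 \<le> G u" by (rule t0(2))
      also have "\<dots> \<le> (\<Sum>k\<in>{1..card I}. B / r)" unfolding G_def
      proof (intro sum_mono)
        fix k assume k: "k \<in> {1..card I}"
        have "norm (power_sum lam I k u) = inverse r ^ k * norm (power_sum lam I k t)"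
          using True by (simp add: pu norm_mult norm_power norm_inverse)
        also have "\<dots> \<le> inverse r ^ 1 * norm (power_sum lam I k t)"
          using k True by (intro mult_right_mono power_decreasing) (auto simp: field_simps)
        also have "\<dots> \<le> B / r" using t k True by (simp add: field_simps)
        finally show "norm (power_sum lam I k u) \<le> B / r" .
      qed
      also have "\<dots> = card I * B / r" by simp
      finally have "r \<le> card I * B / G t0" using True G0 by (simp add: field_simps)
      thus ?thesis by simp
    qed auto
    thus "\<forall>i\<in>I. norm (t i) \<le> max 1 (card I * B / G t0)" using rge by force
  qed
qed auto

definition defect :: "('i \<Rightarrow> complex) \<Rightarrow> 'i set \<Rightarrow> (nat \<Rightarrow> complex) \<Rightarrow> ('i \<Rightarrow> complex) \<Rightarrow> real" where
  "defect lam I c t = (\<Sum>k=1..card I. (norm (power_sum lam I k t - c k))\<^sup>2)"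

lemma defect_attains_min:
  assumes fin: "finite I" and nz: "subset_sums_nonzero lam I"
  shows "\<exists>t. \<forall>s. defect lam I c t \<le> defect lam I c s"
proof -
  define E0 where "E0 = defect lam I c (\<lambda>_. 0)"
  have E0: "E0 \<ge> 0" unfolding E0_def defect_def by (intro sum_nonneg) auto
  define B where "B = sqrt E0 + (\<Sum>k=1..card I. norm (c k))"
  obtain R where R: "\<And>t i. \<forall>k\<in>{1..card I}. norm (power_sum lam I k t) \<le> B \<Longrightarrow> i \<in> I \<Longrightarrow> norm (t i) \<le> R"
    using power_sums_proper[OF fin nz, of B] by blast
  have bnd: "norm (power_sum lam I k t) \<le> B" if "defect lam I c t \<le> E0" "k \<in> {1..card I}" for t k
  proof -
    have "(norm (power_sum lam I k t - c k))\<^sup>2 \<le> defect lam I c t"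
      unfolding defect_def using that(2) by (intro member_le_sum) auto
    hence "norm (power_sum lam I k t - c k) \<le> sqrt E0"
      using that(1) by (intro real_le_rsqrt) auto
    moreover have "norm (c k) \<le> (\<Sum>k=1..card I. norm (c k))"
      using that(2) by (intro member_le_sum) auto
    moreover have "norm (power_sum lam I k t) \<le> norm (power_sum lam I k t - c k) + norm (c k)"
      using norm_triangle_ineq[of "power_sum lam I k t - c k" "c k"] by simp
    ultimately show ?thesis unfolding B_def by linarith
  qed
  have "continuous_on (polydisc I (max R 0)) (defect lam I c)"
    unfolding defect_def by (intro continuous_intros)
  moreover have z: "(\<lambda>_. 0) \<in> polydisc I (max R 0)" by (auto simp: mem_polydisc)
  ultimately obtain t where t: "t \<in> polydisc I (max R 0)" "\<And>s. s \<in> polydisc I (max R 0) \<Longrightarrow> defect lam I c t \<le> defect lam I c s"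
    using continuous_attains_inf[OF compact_polydisc, of I "max R 0" "defect lam I c"] by blast
  have "defect lam I c t \<le> defect lam I c s" for s
  proof (cases "defect lam I c s \<le> E0")
    case True
    hence "norm (s i) \<le> R" if "i \<in> I" for i using R bnd that by blast
    hence "(\<lambda>i. if i \<in> I then s i else 0) \<in> polydisc I (max R 0)"
      by (force simp: mem_polydisc)
    hence "defect lam I c t \<le> defect lam I c (\<lambda>i. if i \<in> I then s i else 0)" by (rule t(2))
    thus ?thesis by (simp add: defect_def power_sum_restrict)
  next
    case False
    thus ?thesis using t(2)[OF z] by (simp add: E0_def)
  qed
  thus ?thesis by blast
qed

definition power_sums_surj :: "('i \<Rightarrow> complex) \<Rightarrow> 'i set \<Rightarrow> bool" where
  "power_sums_surj lam I \<longleftrightarrow> (\<forall>c. \<exists>t. \<forall>k\<in>{1..card I}. power_sum lam I k t = c k)"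

lemma pcompose_power: "pcompose (p ^ n) q = pcompose p q ^ n" for p q :: "'a::comm_semiring_1 poly"
  by (induction n) (simp_all add: pcompose_mult one_pCons)

lemma poly_eq_sum_upto:
  fixes p :: "'a::comm_semiring_1 poly"
  assumes "degree p \<le> n"
  shows "poly p x = (\<Sum>i\<le>n. coeff p i * x ^ i)"
  unfolding poly_altdef using assms by (intro sum.mono_neutral_left) (auto simp: coeff_eq_0)

text \<open>Fixing one coordinate to be 1 turns the vanishing of the power sums below the top one into a system
with one index less. The top power sum of the solution cannot vanish as well, because the coordinate
that was fixed is not 0.\<close>

lemma exists_leading_power_sum:
  assumes fin: "finite J" and nz: "subset_sums_nonzero lam J" and i0: "i0 \<in> J"
    and surj: "power_sums_surj lam (J - {i0})"
  shows "\<exists>e. (\<forall>k\<in>{1..<card J}. power_sum lam J k e = 0) \<and> power_sum lam J (card J) e \<noteq> 0"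
proof -
  have cardJ: "card J = Suc (card (J - {i0}))" by (rule card.remove[OF fin i0])
  obtain t where t: "\<forall>k\<in>{1..card (J - {i0})}. power_sum lam (J - {i0}) k t = - lam i0"
    using surj[unfolded power_sums_surj_def, THEN spec, of "\<lambda>_. - lam i0"] by blast
  define e where "e = t(i0 := 1)"
  have split: "power_sum lam J k e = lam i0 + power_sum lam (J - {i0}) k t" for k
  proof -
    have "power_sum lam J k e = lam i0 * e i0 ^ k + power_sum lam (J - {i0}) k e"
      unfolding power_sum_def by (rule sum.remove[OF fin i0])
    moreover have "power_sum lam (J - {i0}) k e = power_sum lam (J - {i0}) k t"
      unfolding power_sum_def e_def by (intro sum.cong) auto
    ultimately show ?thesis by (simp add: e_def)
  qed
  have 1: "power_sum lam J k e = 0" if "k \<in> {1..<card J}" for k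
    using that split bspec[OF t, of k] cardJ by simp
  moreover have "power_sum lam J (card J) e \<noteq> 0"
  proof
    assume 0: "power_sum lam J (card J) e = 0"
    have "e i0 = 0"
    proof (rule power_sums_zero_imp_zero[OF fin nz _ i0])
      fix k assume "1 \<le> k" "k \<le> card J"
      thus "power_sum lam J k e = 0" using 0 1[of k] by (cases "k = card J") auto
    qed
    thus False by (simp add: e_def)
  qed
  ultimately show ?thesis by blast
qed

text \<open>Otherwise the derivative of \<open>R\<close> would vanish at each value of \<open>t\<close> to an order at least the number of
indices taking that value, hence have \<open>card I\<close> zeros, which exceeds its degree.\<close>

lemma exists_nonvanishing_taylor_coeff:
  fixes t :: "'i \<Rightarrow> complex" and R :: "complex poly"
  assumes fin: "finite I" and deg: "degree R \<le> card I" and nz: "pderiv R \<noteq> 0"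
  shows "\<exists>a j. 1 \<le> j \<and> j \<le> card {i\<in>I. t i = a} \<and> coeff (pcompose R [:a, 1:]) j \<noteq> 0
    \<and> (\<forall>k\<in>{1..<j}. coeff (pcompose R [:a, 1:]) k = 0)"
proof (rule ccontr)
  assume contr: "\<not> ?thesis"
  define g where "g a = card {i\<in>I. t i = a}" for a
  have zero: "coeff (pcompose R [:a, 1:]) k = 0" if "1 \<le> k" "k \<le> g a" for a k
    using that
  proof (induction k rule: less_induct)
    case (less k)
    have "\<forall>m\<in>{1..<k}. coeff (pcompose R [:a, 1:]) m = 0" using less by auto
    thus ?case using contr less.prems unfolding g_def by blast
  qed
  have ord: "g a \<le> order a (pderiv R)" for a
  proof -
    have "coeff (pderiv (pcompose R [:a, 1:])) k = 0" if "k < g a" for k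
      using zero[of "Suc k" a] that by (simp add: coeff_pderiv)
    hence "monom 1 (g a) dvd pderiv (pcompose R [:a, 1:])"
      unfolding monom_1_dvd_iff' by blast
    hence "monom 1 (g a) dvd pcompose (pderiv R) [:a, 1:]"
      by (simp add: pderiv_pcompose pderiv_pCons)
    then obtain S where S: "pcompose (pderiv R) [:a, 1:] = monom 1 (g a) * S" by (elim dvdE)
    have "pderiv R = pcompose (pcompose (pderiv R) [:a, 1:]) [:-a, 1:]"
      by (simp add: pcompose_assoc[symmetric] pcompose_pCons)
    also have "\<dots> = [:-a, 1:] ^ g a * pcompose S [:-a, 1:]"
      unfolding S by (simp add: pcompose_mult monom_altdef pcompose_power pcompose_pCons)
    finally have "[:-a, 1:] ^ g a dvd pderiv R" by (rule dvdI)
    thus ?thesis using nz by (simp add: order_divides)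
  qed
  have "card I = (\<Sum>a\<in>t ` I. g a)"
    unfolding g_def using sum.image_gen[OF fin, of "\<lambda>_. 1::nat" t] by simp
  also have "\<dots> \<le> (\<Sum>a\<in>t ` I. order a (pderiv R))" by (intro sum_mono ord)
  also have "\<dots> \<le> (\<Sum>a | poly (pderiv R) a = 0. order a (pderiv R))"
  proof (rule sum_mono2)
    show "finite {a. poly (pderiv R) a = 0}" using nz by (rule poly_roots_finite)
    show "t ` I \<subseteq> {a. poly (pderiv R) a = 0}"
    proof clarify
      fix i assume i: "i \<in> I"
      hence "g (t i) \<noteq> 0" unfolding g_def using fin by (auto simp: card_eq_0_iff)
      hence "order (t i) (pderiv R) \<noteq> 0" using ord[of "t i"] by simp
      thus "poly (pderiv R) (t i) = 0" by (simp add: order_root)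
    qed
  qed auto
  also have "\<dots> \<le> degree (pderiv R)" using nz by (rule sum_order_le_degree)
  also have "\<dots> < card I"
  proof -
    have "degree R \<noteq> 0" using nz by (auto simp: pderiv_eq_0_iff)
    thus ?thesis using deg by (simp add: degree_pderiv)
  qed
  finally show False by simp
qed

text \<open>Only indices where \<open>t\<close> has the common value \<open>a\<close> are moved. In the binomial expansion the term of order
\<open>m\<close> in \<open>z\<close> is a multiple of the \<open>m\<close>-th power sum of \<open>e\<close>, so all terms below order \<open>j\<close> drop out.\<close>

lemma power_sum_perturb:
  fixes z :: complex
  assumes fin: "finite I" and J: "J \<subseteq> {i\<in>I. t i = a}" and j: "1 \<le> j"
    and e: "\<forall>k\<in>{1..<j}. power_sum lam J k e = 0"
  shows "power_sum lam I k (\<lambda>i. t i + (if i \<in> J then z * e i else 0)) = power_sum lam I k t +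
    z ^ j * (\<Sum>m=j..k. of_nat (k choose m) * a ^ (k - m) * power_sum lam J m e * z ^ (m - j))"
proof -
  have finJ: "finite J" using finite_subset[OF J] fin by simp
  have "power_sum lam I k (\<lambda>i. t i + (if i \<in> J then z * e i else 0)) - power_sum lam I k t
     = (\<Sum>i\<in>I. lam i * ((t i + (if i \<in> J then z * e i else 0)) ^ k - t i ^ k))"
    unfolding power_sum_def by (simp add: sum_subtractf algebra_simps)
  also have "\<dots> = (\<Sum>i\<in>J. lam i * ((a + z * e i) ^ k - a ^ k))"
    using J fin by (intro sum.mono_neutral_cong_right) auto
  also have "\<dots> = (\<Sum>i\<in>J. lam i * (\<Sum>m=1..k. of_nat (k choose m) * a ^ (k - m) * (z * e i) ^ m))"
  proof (intro sum.cong refl arg_cong[where f = "\<lambda>x. lam _ * x"])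
    fix i
    have "(a + z * e i) ^ k = (\<Sum>m\<le>k. of_nat (k choose m) * (z * e i) ^ m * a ^ (k - m))"
      by (subst add.commute) (rule binomial_ring)
    also have "{..k} = insert 0 {1..k}" by auto
    finally show "(a + z * e i) ^ k - a ^ k = (\<Sum>m=1..k. of_nat (k choose m) * a ^ (k - m) * (z * e i) ^ m)"
      by (simp add: mult_ac)
  qed
  also have "\<dots> = (\<Sum>m=1..k. of_nat (k choose m) * a ^ (k - m) * z ^ m * power_sum lam J m e)"
    unfolding power_sum_def sum_distrib_left
    by (subst sum.swap) (simp add: power_mult_distrib mult_ac)
  also have "\<dots> = (\<Sum>m=j..k. of_nat (k choose m) * a ^ (k - m) * z ^ m * power_sum lam J m e)"
    using e j by (intro sum.mono_neutral_right) auto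
  also have "\<dots> = z ^ j * (\<Sum>m=j..k. of_nat (k choose m) * a ^ (k - m) * power_sum lam J m e * z ^ (m - j))"
    unfolding sum_distrib_left
  proof (intro sum.cong refl)
    fix m assume "m \<in> {j..k}"
    hence "z ^ m = z ^ j * z ^ (m - j)" by (simp flip: power_add)
    thus "of_nat (k choose m) * a ^ (k - m) * z ^ m * power_sum lam J m e =
       z ^ j * (of_nat (k choose m) * a ^ (k - m) * power_sum lam J m e * z ^ (m - j))" by simp
  qed
  finally show ?thesis by (simp add: algebra_simps)
qed

text \<open>To leading order the sum of squares changes by \<open>2 * Re (z ^ j * W)\<close>, where \<open>W\<close> is the sum assumed to be
nonzero. Along \<open>z = x * u\<close> with \<open>u ^ j = - cnj W\<close> and \<open>x \<down> 0\<close> this is negative of order \<open>x ^ j\<close>, while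
the quadratic term has order \<open>x ^ (2 * j)\<close>.\<close>

lemma exists_descent_direction:
  fixes c r :: "nat \<Rightarrow> complex" and w :: "nat \<Rightarrow> complex \<Rightarrow> complex"
  assumes j: "1 \<le> j" and K: "finite K" and cont: "\<And>k. continuous_on UNIV (w k)"
    and nz: "(\<Sum>k\<in>K. r k * w k 0) \<noteq> 0"
  shows "\<exists>z. (\<Sum>k\<in>K. (norm (cnj (r k) + z ^ j * w k z))\<^sup>2) < (\<Sum>k\<in>K. (norm (r k))\<^sup>2)"
proof -
  define W where "W z = (\<Sum>k\<in>K. r k * w k z)" for z
  have "j \<noteq> 0" using j by simp
  then obtain u where "- cnj (W 0) = u ^ j" by (rule exists_complex_root)
  hence u: "u ^ j = - cnj (W 0)" by simp
  define p where "p x = 2 * Re (u ^ j * W (of_real x * u)) + x ^ j * norm u ^ (2 * j) * (\<Sum>k\<in>K. (norm (w k (of_real x * u)))\<^sup>2)"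
    for x :: real
  have eq: "(\<Sum>k\<in>K. (norm (cnj (r k) + (of_real x * u) ^ j * w k (of_real x * u)))\<^sup>2) =
      (\<Sum>k\<in>K. (norm (r k))\<^sup>2) + x ^ j * p x" for x :: real
  proof -
    have ReW: "Re (u ^ j * W z) = (\<Sum>k\<in>K. Re (u ^ j * (r k * w k z)))" for z
      unfolding W_def sum_distrib_left Re_sum ..
    have *: "(norm (cnj a + of_real y * b))\<^sup>2 = (norm a)\<^sup>2 + y * (2 * Re (a * b)) + y\<^sup>2 * (norm b)\<^sup>2" for a b y
      unfolding cmod_power2 by (simp add: power2_eq_square algebra_simps)
    have "(\<Sum>k\<in>K. (norm (cnj (r k) + (of_real x * u) ^ j * w k (of_real x * u)))\<^sup>2) =
      (\<Sum>k\<in>K. (norm (r k))\<^sup>2 + x ^ j * (2 * Re (u ^ j * (r k * w k (of_real x * u))))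
         + (x ^ j)\<^sup>2 * (norm u ^ (2 * j) * (norm (w k (of_real x * u)))\<^sup>2))"
    proof (intro sum.cong refl)
      fix k
      have "(of_real x * u) ^ j * w k (of_real x * u) = of_real (x ^ j) * (u ^ j * w k (of_real x * u))"
        by (simp add: power_mult_distrib mult_ac)
      thus "(norm (cnj (r k) + (of_real x * u) ^ j * w k (of_real x * u)))\<^sup>2 =
        (norm (r k))\<^sup>2 + x ^ j * (2 * Re (u ^ j * (r k * w k (of_real x * u))))
         + (x ^ j)\<^sup>2 * (norm u ^ (2 * j) * (norm (w k (of_real x * u)))\<^sup>2)"
        unfolding * by (simp only: *) (simp add: norm_mult norm_power power_mult_distrib power_mult mult_ac flip: power_mult)
    qed
    also have "\<dots> = (\<Sum>k\<in>K. (norm (r k))\<^sup>2) + x ^ j * p x"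
      unfolding p_def sum.distrib sum_distrib_left[symmetric] ReW
      by (simp only: distrib_left power2_eq_square mult.assoc add.assoc)
    finally show ?thesis .
  qed
  have "isCont (w k) z" for k z using cont[of k] by (simp add: continuous_on_eq_continuous_at)
  hence wc: "continuous (at x) (\<lambda>x. w k (of_real x * u))" for k and x :: real
    using isCont_o2[of x "\<lambda>x. of_real x * u" "w k"] by (auto intro!: continuous_intros)
  have "isCont p 0" unfolding p_def W_def by (intro continuous_intros continuous_Re wc)
  hence "(p \<longlongrightarrow> p 0) (at_right 0)"
    unfolding isCont_def by (rule tendsto_within_subset) simp
  moreover have "p 0 < 0"
  proof -
    have "p 0 = - (2 * Re (cnj (W 0) * W 0))" using j by (simp add: p_def u)
    also have "Re (cnj (W 0) * W 0) = (norm (W 0))\<^sup>2"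
      unfolding cmod_power2 by (simp add: power2_eq_square)
    finally show ?thesis using nz by (simp add: W_def)
  qed
  ultimately have "eventually (\<lambda>x. p x < 0) (at_right 0)" by (auto dest: order_tendstoD)
  moreover have "eventually (\<lambda>x. x > (0::real)) (at_right 0)" by (rule eventually_at_right_less)
  ultimately have "eventually (\<lambda>x. p x < 0 \<and> x > 0) (at_right 0)" by (rule eventually_conj)
  then obtain x where x: "p x < 0" "x > 0"
    using eventually_happens'[of "at_right (0::real)"] by (auto simp: trivial_limit_at_right_real)
  hence "x ^ j * p x < 0" by (simp add: mult_pos_neg)
  thus ?thesis using eq[of x] by (intro exI[of _ "of_real x * u"]) linarith
qed

text \<open>The conjugated residuals \<open>r k\<close> are the coefficients of a polynomial \<open>R\<close>. If the values of \<open>t\<close> are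
distinct, a critical point of the defect makes the derivative of \<open>R\<close> vanish at \<open>card I\<close> points, so the
residuals are 0. At coinciding values one has to go beyond first order: some value \<open>a\<close> is taken by at
least \<open>j\<close> indices, where \<open>j\<close> is the order of the first nonconstant Taylor term of \<open>R\<close> at \<open>a\<close>, and
moving \<open>j\<close> of these indices in a direction whose power sums below the \<open>j\<close>-th vanish decreases the
defect.\<close>

lemma defect_descent:
  assumes fin: "finite I" and nz: "subset_sums_nonzero lam I"
    and IH: "\<And>J. J \<subset> I \<Longrightarrow> power_sums_surj lam J"
    and k: "k \<in> {1..card I}" "power_sum lam I k t \<noteq> c k"
  shows "\<exists>s. defect lam I c s < defect lam I c t"
proof -
  define N where "N = card I"
  define r where "r k = cnj (power_sum lam I k t - c k)" for k
  define R where "R = (\<Sum>k=1..N. monom (r k) k)"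
  have coeffR: "coeff R m = (if m \<in> {1..N} then r m else 0)" for m
    by (simp add: R_def coeff_sum sum.delta)
  have "r k \<noteq> 0" using k(2) by (simp add: r_def)
  hence "coeff (pderiv R) (k - 1) \<noteq> 0" using k(1) by (simp add: coeff_pderiv coeffR N_def)
  hence "pderiv R \<noteq> 0" by force
  moreover have "degree R \<le> N" by (rule degree_le) (simp add: coeffR)
  ultimately obtain a j where aj: "1 \<le> j" "j \<le> card {i\<in>I. t i = a}"
    "coeff (pcompose R [:a, 1:]) j \<noteq> 0"
    using exists_nonvanishing_taylor_coeff[OF fin, of R t] unfolding N_def by blast
  obtain J where J: "J \<subseteq> {i\<in>I. t i = a}" "card J = j" "finite J"
    using obtain_subset_with_card_n[OF aj(2)] by blast
  have JI: "J \<subseteq> I" using J(1) by blast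
  obtain i0 where i0: "i0 \<in> J" using J aj(1) by fastforce
  have "J - {i0} \<subset> I" using JI i0 by blast
  then obtain e where e: "\<forall>k\<in>{1..<j}. power_sum lam J k e = 0" "power_sum lam J j e \<noteq> 0"
    using exists_leading_power_sum[OF J(3) subset_sums_nonzero_mono[OF nz JI] i0 IH] J(2) by blast
  define w where "w k z = (\<Sum>m=j..k. of_nat (k choose m) * a ^ (k - m) * power_sum lam J m e * z ^ (m - j))"
    for k z
  have "coeff (pcompose R [:a, 1:]) j * power_sum lam J j e = (\<Sum>k=1..N. r k * w k 0)"
  proof -
    have "coeff (pcompose (monom (r k) k) [:a, 1:]) j * power_sum lam J j e = r k * w k 0" for k
    proof -
      have "pcompose (monom (r k) k) [:a, 1:] = smult (r k) ([:a, 1:] ^ k)"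
        by (simp add: monom_altdef pcompose_smult pcompose_power pcompose_pCons)
      moreover have "coeff ([:a, 1:] ^ k) j = (if j \<le> k then of_nat (k choose j) * a ^ (k - j) else 0)"
        using coeff_linear_poly_power[of j k a 1]
        by (auto simp: coeff_eq_0 degree_linear_power)
      moreover have "w k 0 = (if j \<le> k then of_nat (k choose j) * a ^ (k - j) * power_sum lam J j e else 0)"
      proof (cases "j \<le> k")
        case True
        have "w k 0 = (\<Sum>m\<in>{j}. of_nat (k choose m) * a ^ (k - m) * power_sum lam J m e * 0 ^ (m - j))"
          unfolding w_def using True by (intro sum.mono_neutral_right) auto
        thus ?thesis using True by simp
      qed (simp add: w_def)
      ultimately show ?thesis by simp
    qed
    thus ?thesis by (simp add: R_def pcompose_sum coeff_sum sum_distrib_right)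
  qed
  hence "(\<Sum>k=1..N. r k * w k 0) \<noteq> 0" using aj(3) e(2) by auto
  moreover have "continuous_on UNIV (w k)" for k unfolding w_def by (intro continuous_intros)
  ultimately obtain z where z: "(\<Sum>k=1..N. (norm (cnj (r k) + z ^ j * w k z))\<^sup>2) < (\<Sum>k=1..N. (norm (r k))\<^sup>2)"
    using exists_descent_direction[OF aj(1), of "{1..N}" w r] by auto
  define s where "s i = t i + (if i \<in> J then z * e i else 0)" for i
  have eq: "power_sum lam I k s - c k = cnj (r k) + z ^ j * w k z" for k
    unfolding s_def power_sum_perturb[OF fin J(1) aj(1) e(1)] r_def w_def by simp
  have "norm (r k) = norm (power_sum lam I k t - c k)" for k
    by (simp only: r_def complex_mod_cnj)
  hence "defect lam I c s < defect lam I c t"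
    using z unfolding defect_def N_def eq by simp
  thus ?thesis by blast
qed

text \<open>A minimiser of the defect exists by properness, and it has defect 0 because otherwise the defect could
be decreased; the descent direction comes from smaller instances of the same statement.\<close>

theorem subset_sums_nonzero_imp_power_sums_surj:
  assumes fin: "finite I" and nz: "subset_sums_nonzero lam I"
  shows "power_sums_surj lam I"
  using assms
proof (induction I rule: finite_psubset_induct)
  case (psubset I)
  show ?case unfolding power_sums_surj_def
  proof
    fix c
    obtain t where t: "\<And>s. defect lam I c t \<le> defect lam I c s"
      using defect_attains_min[OF psubset.hyps psubset.prems] by blast
    have "power_sum lam I k t = c k" if k: "k \<in> {1..card I}" for k
    proof (rule ccontr)
      assume "power_sum lam I k t \<noteq> c k"
      moreover have "power_sums_surj lam J" if "J \<subset> I" for J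
        using that psubset.IH subset_sums_nonzero_mono[OF psubset.prems] by (simp add: psubset_imp_subset)
      ultimately obtain s where "defect lam I c s < defect lam I c t"
        using defect_descent[OF psubset.hyps psubset.prems _ k] by blast
      thus False using t[of s] by simp
    qed
    thus "\<exists>t. \<forall>k\<in>{1..card I}. power_sum lam I k t = c k" by blast
  qed
qed

text \<open>The integral of \<open>pderiv P\<close> over the unit interval is \<open>poly P 1 - poly P 0\<close>. A quadrature rule with the
given weights, up to normalisation by their sum, is exact on powers up to \<open>card I\<close> if and only if its
nodes have prescribed power sums.\<close>

lemma quadrature_nodes:
  fixes lam :: "'i \<Rightarrow> complex"
  assumes fin: "finite I" and nz: "subset_sums_nonzero lam I"
  shows "\<exists>t. \<forall>P. degree P \<le> Suc (card I) \<longrightarrow>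
    sum lam I * (poly P 1 - poly P 0) = (\<Sum>i\<in>I. lam i * poly (pderiv P) (t i))"
proof -
  obtain t where "\<forall>k\<in>{1..card I}. power_sum lam I k t = sum lam I / of_nat (Suc k)"
    using subset_sums_nonzero_imp_power_sums_surj[OF assms] unfolding power_sums_surj_def
    by (elim allE[of _ "\<lambda>k. sum lam I / of_nat (Suc k)"]) auto
  hence t: "power_sum lam I k t = sum lam I / of_nat (Suc k)" if "k \<le> card I" for k
    using that by (cases "k = 0") (auto simp: power_sum_def)
  show ?thesis
  proof (intro exI allI impI)
    fix P :: "complex poly" assume P: "degree P \<le> Suc (card I)"
    have "(\<Sum>i\<in>I. lam i * poly (pderiv P) (t i)) = (\<Sum>i\<in>I. lam i * (\<Sum>k\<le>card I. coeff (pderiv P) k * t i ^ k))"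
      using P by (subst poly_eq_sum_upto[of _ "card I"]) (simp_all add: degree_pderiv)
    also have "\<dots> = (\<Sum>k\<le>card I. coeff (pderiv P) k * power_sum lam I k t)"
      unfolding power_sum_def sum_distrib_left by (subst sum.swap) (simp add: mult_ac)
    also have "\<dots> = (\<Sum>k\<le>card I. sum lam I * coeff P (Suc k))"
      by (intro sum.cong refl) (simp add: t coeff_pderiv del: of_nat_Suc)
    also have "\<dots> = sum lam I * (\<Sum>k\<le>card I. coeff P (Suc k))"
      by (simp add: sum_distrib_left)
    also have "(\<Sum>k\<le>card I. coeff P (Suc k)) = poly P 1 - poly P 0"
      using poly_eq_sum_upto[OF P, of 1]
      unfolding sum.atMost_Suc_shift by (simp add: poly_0_coeff_0)
    finally show "sum lam I * (poly P 1 - poly P 0) = (\<Sum>i\<in>I. lam i * poly (pderiv P) (t i))" by simp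
  qed
qed

section \<open>Polynomial functions\<close>

definition monomial_fun :: "('n::finite \<Rightarrow>\<^sub>0 nat) \<Rightarrow> complex^'n \<Rightarrow> complex" where
  "monomial_fun e x = (\<Prod>i\<in>UNIV. (x $ i) ^ Poly_Mapping.lookup e i)"

lemma monomial_fun_add: "monomial_fun (d + e) x = monomial_fun d x * monomial_fun e x"
  by (simp add: monomial_fun_def lookup_add power_add prod.distrib)

lemma poly_eval_superset:
  assumes "finite S" "Poly_Mapping.keys p \<subseteq> S"
  shows "poly_eval p x = (\<Sum>e\<in>S. Poly_Mapping.lookup p e * monomial_fun e x)"
  unfolding poly_eval_def monomial_fun_def using assms
  by (intro sum.mono_neutral_left) (auto simp: in_keys_iff)

lemma poly_eval_0 [simp]: "poly_eval 0 x = 0"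
  by (simp add: poly_eval_def)

lemma poly_eval_add: "poly_eval (p + q) x = poly_eval p x + poly_eval q x"
  using Poly_Mapping.keys_add[of p q]
  by (subst (1 2 3) poly_eval_superset[of "Poly_Mapping.keys p \<union> Poly_Mapping.keys q"])
     (auto simp: lookup_add algebra_simps sum.distrib)

lemma poly_eval_sum: "poly_eval (sum f A) x = (\<Sum>a\<in>A. poly_eval (f a) x)"
  by (induction A rule: infinite_finite_induct) (auto simp: poly_eval_add)

lemma poly_eval_single: "poly_eval (Poly_Mapping.single e c) x = c * monomial_fun e x"
  by (subst poly_eval_superset[of "{e}"]) auto

lemma sum_monomials: "(\<Sum>e\<in>Poly_Mapping.keys p. Poly_Mapping.single e (Poly_Mapping.lookup p e)) = p"
  by (rule poly_mapping_eqI) (auto simp: lookup_sum lookup_single when_def sum.delta in_keys_iff)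

lemma poly_eval_mult: "poly_eval (p * q) x = poly_eval p x * poly_eval q x"
proof -
  have "p * q = (\<Sum>d\<in>Poly_Mapping.keys p. \<Sum>e\<in>Poly_Mapping.keys q.
      Poly_Mapping.single (d + e) (Poly_Mapping.lookup p d * Poly_Mapping.lookup q e))"
    by (subst (1) sum_monomials[of p, symmetric], subst (1) sum_monomials[of q, symmetric])
       (simp add: sum_product mult_single)
  hence "poly_eval (p * q) x = (\<Sum>d\<in>Poly_Mapping.keys p. \<Sum>e\<in>Poly_Mapping.keys q.
      (Poly_Mapping.lookup p d * monomial_fun d x) * (Poly_Mapping.lookup q e * monomial_fun e x))"
    by (simp add: poly_eval_sum poly_eval_single monomial_fun_add mult_ac)
  also have "\<dots> = poly_eval p x * poly_eval q x"
    by (simp add: poly_eval_def monomial_fun_def sum_product)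
  finally show ?thesis .
qed

lemma poly_eval_const: "poly_eval (Poly_Mapping.single 0 c) x = c"
  by (simp add: poly_eval_single monomial_fun_def)

lemma monomial_fun_var: "monomial_fun (Poly_Mapping.single i 1) x = x $ i"
proof -
  have "monomial_fun (Poly_Mapping.single i 1) x = (\<Prod>j\<in>UNIV. if j = i then x $ i else 1)"
    unfolding monomial_fun_def by (intro prod.cong) (auto simp: lookup_single when_def)
  thus ?thesis by simp
qed

lemma poly_eval_var: "poly_eval (Poly_Mapping.single (Poly_Mapping.single i 1) 1) x = x $ i"
  by (simp add: poly_eval_single monomial_fun_var del: One_nat_def)

definition line_poly :: "'n::finite cpoly \<Rightarrow> complex^'n \<Rightarrow> complex^'n \<Rightarrow> complex poly" where
  "line_poly p a v = (\<Sum>e\<in>Poly_Mapping.keys p.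
     smult (Poly_Mapping.lookup p e) (\<Prod>i\<in>UNIV. [:a $ i, v $ i:] ^ Poly_Mapping.lookup e i))"

lemma poly_line_poly: "poly (line_poly p a v) s = poly_eval p (a + s *s v)"
  by (simp add: line_poly_def poly_eval_def poly_sum poly_prod poly_power)

lemma degree_line_poly_le: "degree (line_poly p a v) \<le> total_degree p"
  unfolding line_poly_def
proof (intro degree_sum_le finite_keys)
  fix e assume e: "e \<in> Poly_Mapping.keys p"
  have "degree (smult (Poly_Mapping.lookup p e) (\<Prod>i\<in>UNIV. [:a $ i, v $ i:] ^ Poly_Mapping.lookup e i))
      \<le> degree (\<Prod>i\<in>UNIV. [:a $ i, v $ i:] ^ Poly_Mapping.lookup e i)"
    by (rule degree_smult_le)
  also have "\<dots> \<le> (\<Sum>i\<in>UNIV. degree ([:a $ i, v $ i:] ^ Poly_Mapping.lookup e i))"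
    using degree_prod_sum_le[of UNIV "\<lambda>i. [:a $ i, v $ i:] ^ Poly_Mapping.lookup e i"]
    by (simp add: o_def)
  also have "\<dots> \<le> (\<Sum>i\<in>UNIV. Poly_Mapping.lookup e i)"
  proof (intro sum_mono)
    fix i
    have "degree ([:a $ i, v $ i:] ^ Poly_Mapping.lookup e i) \<le> degree [:a $ i, v $ i:] * Poly_Mapping.lookup e i"
      by (rule degree_power_le)
    also have "\<dots> \<le> 1 * Poly_Mapping.lookup e i" by (intro mult_right_mono) auto
    finally show "degree ([:a $ i, v $ i:] ^ Poly_Mapping.lookup e i) \<le> Poly_Mapping.lookup e i" by simp
  qed
  also have "\<dots> \<le> total_degree p"
    unfolding total_degree_def using e by (intro Max_ge) auto
  finally show "degree (smult (Poly_Mapping.lookup p e)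
     (\<Prod>i\<in>UNIV. [:a $ i, v $ i:] ^ Poly_Mapping.lookup e i)) \<le> total_degree p" .
qed

lemma poly_eval_zero_divisors:
  assumes "\<And>x. poly_eval p x * poly_eval q x = 0"
  shows "(\<forall>x. poly_eval p x = 0) \<or> (\<forall>x. poly_eval q x = 0)"
proof (rule ccontr)
  assume "\<not> ?thesis"
  then obtain a b where ab: "poly_eval p a \<noteq> 0" "poly_eval q b \<noteq> 0" by blast
  have "poly (line_poly p a (b - a)) 0 \<noteq> 0" "poly (line_poly q a (b - a)) 1 \<noteq> 0"
    using ab by (simp_all add: poly_line_poly)
  hence "line_poly p a (b - a) * line_poly q a (b - a) \<noteq> 0" by auto
  moreover have "poly (line_poly p a (b - a) * line_poly q a (b - a)) s = 0" for s
    using assms by (simp add: poly_line_poly)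
  ultimately show False using poly_all_0_iff_0 by blast
qed

text \<open>
In the ring of polynomial functions an identity can be checked by evaluation at points, and the
absence of zero divisors reduces to polynomials in one variable by restriction to a line.\<close>

typedef (overloaded) 'n polyfun = "range (poly_eval :: 'n::finite cpoly \<Rightarrow> _)"
  morphisms ev Abs_polyfun by blast

setup_lifting type_definition_polyfun

lemma ev_inject: "(\<And>x. ev f x = ev g x) \<Longrightarrow> f = g"
  by (metis ext ev_inject)

instantiation polyfun :: (finite) comm_ring_1
begin
lift_definition zero_polyfun :: "'a polyfun" is "\<lambda>_. 0"
  by (rule range_eqI[of _ _ 0]) auto
lift_definition one_polyfun :: "'a polyfun" is "\<lambda>_. 1"
  by (rule range_eqI[of _ _ 1]) (use poly_eval_const[of 1] in \<open>auto simp: fun_eq_iff\<close>)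
lift_definition plus_polyfun :: "'a polyfun \<Rightarrow> 'a polyfun \<Rightarrow> 'a polyfun" is "\<lambda>f g x. f x + g x"
  by (metis (no_types, lifting) ext imageE poly_eval_add rangeI)
lift_definition times_polyfun :: "'a polyfun \<Rightarrow> 'a polyfun \<Rightarrow> 'a polyfun" is "\<lambda>f g x. f x * g x"
  by (metis (no_types, lifting) ext imageE poly_eval_mult rangeI)
lift_definition uminus_polyfun :: "'a polyfun \<Rightarrow> 'a polyfun" is "\<lambda>f x. - f x"
proof -
  fix f :: "complex^'a \<Rightarrow> complex" assume "f \<in> range poly_eval"
  then obtain p where "f = poly_eval p" by blast
  thus "(\<lambda>x. - f x) \<in> range poly_eval"
    by (intro range_eqI[of _ _ "Poly_Mapping.single 0 (-1) * p"]) (auto simp: poly_eval_mult poly_eval_const)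
qed
lift_definition minus_polyfun :: "'a polyfun \<Rightarrow> 'a polyfun \<Rightarrow> 'a polyfun" is "\<lambda>f g x. f x - g x"
proof -
  fix f g :: "complex^'a \<Rightarrow> complex" assume "f \<in> range poly_eval" "g \<in> range poly_eval"
  then obtain p q where "f = poly_eval p" "g = poly_eval q" by blast
  thus "(\<lambda>x. f x - g x) \<in> range poly_eval"
    by (intro range_eqI[of _ _ "p + Poly_Mapping.single 0 (-1) * q"]) (auto simp: poly_eval_add poly_eval_mult poly_eval_const)
qed
instance
  by standard (transfer; force simp: algebra_simps fun_eq_iff)+
end

instance polyfun :: (finite) idom
proof
  fix a b :: "'a polyfun"
  assume "a \<noteq> 0" "b \<noteq> 0"
  thus "a * b \<noteq> 0"
    by transfer (use poly_eval_zero_divisors in \<open>auto simp: fun_eq_iff\<close>)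
qed

lift_definition cst :: "complex \<Rightarrow> 'n::finite polyfun" is "\<lambda>c _. c"
  by (rule range_eqI[of _ _ "Poly_Mapping.single 0 _"]) (auto simp: poly_eval_const)

lift_definition coord :: "'n::finite \<Rightarrow> 'n polyfun" is "\<lambda>i x. x $ i"
  by (rule range_eqI[of _ _ "Poly_Mapping.single (Poly_Mapping.single _ 1) 1"]) (auto simp: poly_eval_var simp del: One_nat_def)

lift_definition polyfun_of :: "'n::finite cpoly \<Rightarrow> 'n polyfun" is poly_eval by blast

lemma ev_polyfun_of [simp]: "ev (polyfun_of p) x = poly_eval p x" by transfer simp
lemma ev_eq_poly_eval: "\<exists>p. \<forall>x. ev f x = poly_eval p x" by transfer auto

lemma ev_simps [simp]:
  "ev 0 x = 0" "ev 1 x = 1" "ev (f + g) x = ev f x + ev g x" "ev (f * g) x = ev f x * ev g x"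
  "ev (- f) x = - ev f x" "ev (f - g) x = ev f x - ev g x" "ev (cst c) x = c" "ev (coord i) x = x $ i"
  by (transfer; simp)+

lemma ev_power [simp]: "ev (f ^ n) x = ev f x ^ n" by (induction n) auto
lemma ev_sum [simp]: "ev (sum f A) x = (\<Sum>a\<in>A. ev (f a) x)"
  by (induction A rule: infinite_finite_induct) auto
lemma ev_prod [simp]: "ev (prod f A) x = (\<Prod>a\<in>A. ev (f a) x)"
  by (induction A rule: infinite_finite_induct) auto

lemma cst_simps [simp]: "cst 0 = 0" "cst 1 = 1" "cst c = cst d \<longleftrightarrow> c = d" "cst c = 0 \<longleftrightarrow> c = 0"
  by (transfer; simp add: fun_eq_iff)+

lemma polyfun_induct [case_names cst coord add mult]:
  assumes "\<And>c. P (cst c)" "\<And>i. P (coord i)" "\<And>f g. P f \<Longrightarrow> P g \<Longrightarrow> P (f + g)" "\<And>f g. P f \<Longrightarrow> P g \<Longrightarrow> P (f * g)"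
  shows "P f"
proof -
  have 1: "P 0" "P 1" using assms(1)[of 0] assms(1)[of 1] by simp_all
  have sum: "(\<And>a. a \<in> A \<Longrightarrow> P (h a)) \<Longrightarrow> P (sum h A)" for h :: "'b \<Rightarrow> 'a polyfun" and A
    by (induction A rule: infinite_finite_induct) (auto intro: assms 1)
  have prod: "(\<And>a. a \<in> A \<Longrightarrow> P (h a)) \<Longrightarrow> P (prod h A)" for h :: "'b \<Rightarrow> 'a polyfun" and A
    by (induction A rule: infinite_finite_induct) (auto intro: assms 1)
  have pow: "P h \<Longrightarrow> P (h ^ n)" for h n
    by (induction n) (auto intro: assms 1)
  obtain p where p: "\<And>x. ev f x = poly_eval p x" using ev_eq_poly_eval by blast
  have "f = (\<Sum>e\<in>Poly_Mapping.keys p. cst (Poly_Mapping.lookup p e) * (\<Prod>i\<in>UNIV. coord i ^ Poly_Mapping.lookup e i))"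
    by (rule ev_inject) (simp add: p poly_eval_def)
  thus ?thesis by (metis (no_types, lifting) sum prod pow assms)
qed

lemma ev_line: "\<exists>P. \<forall>s. ev f (a + s *s v) = poly P s"
  using ev_eq_poly_eval[of f] poly_line_poly by metis

lemma continuous_on_ev: "continuous_on S (ev f)"
  by (induction f rule: polyfun_induct) (auto intro!: continuous_intros simp: fun_eq_iff cong: continuous_on_cong)

text \<open>Every point is joined to a point of the open set by a complex line, on which the function is a
polynomial in one variable with infinitely many zeros.\<close>

lemma polyfun_zero_on_open:
  assumes S: "open S" "S \<noteq> {}" and z: "\<And>x. x \<in> S \<Longrightarrow> ev f x = 0"
  shows "f = 0"
proof (rule ev_inject)
  fix b
  obtain a where a: "a \<in> S" using S by blast
  obtain P where P: "\<And>s. ev f (a + s *s (b - a)) = poly P s" using ev_line by blast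
  have "continuous_on UNIV (\<lambda>s::complex. \<chi> i. a $ i + s * (b - a) $ i)"
    by (intro continuous_on_vec_lambda continuous_intros)
  hence "open ((\<lambda>s::complex. \<chi> i. a $ i + s * (b - a) $ i) -` S)"
    using S(1) by (simp add: continuous_on_open_vimage)
  moreover have "(\<lambda>s::complex. \<chi> i. a $ i + s * (b - a) $ i) = (\<lambda>s. a + s *s (b - a))"
    by (auto simp: fun_eq_iff vec_eq_iff algebra_simps)
  ultimately have "open ((\<lambda>s. a + s *s (b - a)) -` S)" by simp
  moreover have "0 \<in> (\<lambda>s. a + s *s (b - a)) -` S" using a by simp
  ultimately have "infinite ((\<lambda>s. a + s *s (b - a)) -` S)"
    using finite_imp_not_open by blast
  moreover have "(\<lambda>s. a + s *s (b - a)) -` S \<subseteq> {s. poly P s = 0}"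
    using z by (auto simp flip: P)
  ultimately have "P = 0" using poly_roots_finite[of P] finite_subset by blast
  thus "ev f b = ev 0 b" using P[of 1] by simp
qed

text \<open>On each line the function is a polynomial in one variable without zeros.\<close>

lemma nonvanishing_polyfun_constant:
  assumes "\<And>x. ev f x \<noteq> 0"
  shows "\<exists>c. f = cst c"
proof -
  have "ev f a = ev f b" for a b
  proof -
    obtain P where P: "\<And>s. ev f (a + s *s (b - a)) = poly P s" using ev_line by blast
    have "constant (poly P)" using fundamental_theorem_of_algebra[of P] assms P by metis
    hence "poly P 0 = poly P 1" unfolding constant_def by blast
    thus ?thesis using P[of 0] P[of 1] by simp
  qed
  hence "f = cst (ev f 0)" by (intro ev_inject) simp
  thus ?thesis by blast
qed

text \<open>A polynomial over the polynomial functions is a polynomial function of a point \<open>y\<close> and of one further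
variable \<open>s\<close>, with respect to which it has a degree and a leading coefficient.\<close>

definition eval2 :: "'n::finite polyfun poly \<Rightarrow> complex^'n \<Rightarrow> complex \<Rightarrow> complex" where
  "eval2 P y s = ev (poly P (cst s)) y"

lemma eval2_simps [simp]:
  "eval2 0 y s = 0" "eval2 1 y s = 1" "eval2 (P + Q) y s = eval2 P y s + eval2 Q y s"
  "eval2 (P * Q) y s = eval2 P y s * eval2 Q y s" "eval2 (P - Q) y s = eval2 P y s - eval2 Q y s"
  "eval2 (smult f P) y s = ev f y * eval2 P y s" "eval2 [:f:] y s = ev f y"
  "eval2 (pCons f P) y s = ev f y + s * eval2 P y s"
  by (simp_all add: eval2_def)

lemma eval2_inject:
  assumes "\<And>y s. eval2 P y s = eval2 Q y s"
  shows "P = Q"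
proof (rule ccontr)
  assume "P \<noteq> Q"
  hence "finite {z. poly (P - Q) z = 0}" by (intro poly_roots_finite) simp
  moreover have "poly (P - Q) (cst s) = 0" for s
    by (rule ev_inject) (use assms in \<open>simp add: eval2_def\<close>)
  hence "range cst \<subseteq> {z. poly (P - Q) z = 0}" by blast
  ultimately have "finite (range (cst :: complex \<Rightarrow> 'a polyfun))" by (rule finite_subset[rotated])
  hence "finite (UNIV :: complex set)" by (rule finite_imageD) (simp add: inj_on_def)
  thus False using infinite_UNIV_char_0 by blast
qed

definition at_point :: "complex^'n::finite \<Rightarrow> 'n polyfun poly \<Rightarrow> complex poly" where
  "at_point y P = map_poly (\<lambda>f. ev f y) P"

lemma coeff_at_point [simp]: "coeff (at_point y P) k = ev (coeff P k) y"
  by (simp add: at_point_def coeff_map_poly)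

lemma poly_at_point: "poly (at_point y P) s = eval2 P y s"
  by (induction P) (auto simp: at_point_def map_poly_pCons eval2_def)

lemma degree_at_point_le: "degree (at_point y P) \<le> degree P"
  by (rule degree_le) (simp add: coeff_eq_0)

lemma eval2_substitute:
  "\<exists>W. \<forall>x s. eval2 W x s = ev f (\<chi> k. eval2 (u k) x s)"
proof (induction f rule: polyfun_induct)
  case (cst c)
  show ?case by (rule exI[of _ "[:cst c:]"]) simp
next
  case (coord i)
  show ?case by (rule exI[of _ "u i"]) simp
next
  case (add f g)
  then obtain W1 W2 where "\<forall>x s. eval2 W1 x s = ev f (\<chi> k. eval2 (u k) x s)"
    "\<forall>x s. eval2 W2 x s = ev g (\<chi> k. eval2 (u k) x s)" by blast
  thus ?case by (intro exI[of _ "W1 + W2"]) simp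
next
  case (mult f g)
  then obtain W1 W2 where "\<forall>x s. eval2 W1 x s = ev f (\<chi> k. eval2 (u k) x s)"
    "\<forall>x s. eval2 W2 x s = ev g (\<chi> k. eval2 (u k) x s)" by blast
  thus ?case by (intro exI[of _ "W1 * W2"]) simp
qed

section \<open>Means of the Jacobian matrix\<close>

lemma poly_eval_partial_deriv:
  "poly_eval (partial_deriv k p) x = (\<Sum>e\<in>Poly_Mapping.keys p. Poly_Mapping.lookup p e *
     (of_nat (Poly_Mapping.lookup e k) * x $ k ^ (Poly_Mapping.lookup e k - 1) *
       (\<Prod>i\<in>UNIV - {k}. x $ i ^ Poly_Mapping.lookup e i)))"
  unfolding partial_deriv_def poly_eval_sum poly_eval_single
proof (intro sum.cong refl)
  fix e
  have "monomial_fun (e - Poly_Mapping.single k 1) x =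
      x $ k ^ (Poly_Mapping.lookup e k - 1) * (\<Prod>i\<in>UNIV - {k}. x $ i ^ Poly_Mapping.lookup e i)"
    unfolding monomial_fun_def
    by (subst prod.remove[of _ k]) (auto simp: minus_poly_mapping.rep_eq lookup_single when_def intro!: prod.cong)
  thus "of_nat (Poly_Mapping.lookup e k) * Poly_Mapping.lookup p e * monomial_fun (e - Poly_Mapping.single k 1) x =
    Poly_Mapping.lookup p e * (of_nat (Poly_Mapping.lookup e k) * x $ k ^ (Poly_Mapping.lookup e k - 1) *
       (\<Prod>i\<in>UNIV - {k}. x $ i ^ Poly_Mapping.lookup e i))"
    by simp
qed

lemma pderiv_sum: "pderiv (sum f A) = (\<Sum>a\<in>A. pderiv (f a))"
  by (induction A rule: infinite_finite_induct) (auto simp: pderiv_add)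

text \<open>The chain rule.\<close>

lemma poly_pderiv_line_poly:
  "poly (pderiv (line_poly p a v)) s = (\<Sum>k\<in>UNIV. poly_eval (partial_deriv k p) (a + s *s v) * v $ k)"
proof -
  have "poly (pderiv (line_poly p a v)) s = (\<Sum>e\<in>Poly_Mapping.keys p. \<Sum>k\<in>UNIV. Poly_Mapping.lookup p e *
     (of_nat (Poly_Mapping.lookup e k) * (a + s *s v) $ k ^ (Poly_Mapping.lookup e k - 1) *
       (\<Prod>i\<in>UNIV - {k}. (a + s *s v) $ i ^ Poly_Mapping.lookup e i)) * v $ k)"
    unfolding line_poly_def
    by (simp add: pderiv_sum pderiv_smult pderiv_prod pderiv_power pderiv_pCons poly_sum poly_prod poly_power
        sum_distrib_left mult_ac)
  also have "\<dots> = (\<Sum>k\<in>UNIV. poly_eval (partial_deriv k p) (a + s *s v) * v $ k)"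
    unfolding poly_eval_partial_deriv by (subst sum.swap) (simp add: sum_distrib_right)
  finally show ?thesis .
qed

text \<open>If the \<open>t i\<close> are the nodes of the quadrature rule and \<open>F\<close> has degree at most \<open>N + 1\<close>, this is the sum of
the weights times the integral of the Jacobian matrix over the segment from \<open>a\<close> to \<open>b\<close>.\<close>

definition node_matrix :: "('n::finite, 'm::finite) polymap \<Rightarrow> nat \<Rightarrow> (nat \<Rightarrow> complex) \<Rightarrow> (nat \<Rightarrow> complex)
    \<Rightarrow> complex^'n \<Rightarrow> complex^'n \<Rightarrow> complex^'n^'m" where
  "node_matrix F N lam t a b =
     (\<Sum>i=1..N. smult_matrix (lam i) (eval_matrix (jacobian_matrix F) (a + t i *s (b - a))))"

lemma node_matrix_entry:
  "node_matrix F N lam t a b $ j $ k =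
     (\<Sum>i=1..N. lam i * poly_eval (partial_deriv k (F $ j)) (a + t i *s (b - a)))"
  by (simp add: node_matrix_def smult_matrix_def eval_matrix_def jacobian_matrix_def)

text \<open>The fundamental theorem of calculus on the segment from \<open>a\<close> to \<open>b\<close>, with the integral evaluated by the
quadrature rule. Here \<open>L\<close> is the sum of the weights, as the case of linear \<open>P\<close> shows.\<close>

lemma node_matrix_difference:
  assumes deg: "polymap_degree F \<le> Suc N"
    and t: "\<And>P. degree P \<le> Suc N \<Longrightarrow> L * (poly P 1 - poly P 0) = (\<Sum>i=1..N. lam i * poly (pderiv P) (t i))"
  shows "node_matrix F N lam t a b *v (b - a) = L *s (polymap_fun F b - polymap_fun F a)"
proof (rule vec_eq_iff[THEN iffD2], rule allI)
  fix j
  have "total_degree (F $ j) \<le> polymap_degree F"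
    unfolding polymap_degree_def by (intro Max_ge) auto
  hence "degree (line_poly (F $ j) a (b - a)) \<le> Suc N"
    using degree_line_poly_le[of "F $ j" a "b - a"] deg by linarith
  hence "(\<Sum>i=1..N. lam i * poly (pderiv (line_poly (F $ j) a (b - a))) (t i)) =
     L * (poly_eval (F $ j) b - poly_eval (F $ j) a)"
    using t[of "line_poly (F $ j) a (b - a)"] by (simp add: poly_line_poly)
  moreover have "(\<Sum>i=1..N. lam i * poly (pderiv (line_poly (F $ j) a (b - a))) (t i)) =
      (node_matrix F N lam t a b *v (b - a)) $ j"
  proof -
    have "(\<Sum>i=1..N. lam i * poly (pderiv (line_poly (F $ j) a (b - a))) (t i)) =
      (\<Sum>i=1..N. \<Sum>k\<in>UNIV. lam i * (poly_eval (partial_deriv k (F $ j)) (a + t i *s (b - a)) * (b - a) $ k))"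
      by (simp only: poly_pderiv_line_poly sum_distrib_left)
    also have "\<dots> = (\<Sum>k\<in>UNIV. \<Sum>i=1..N. lam i * (poly_eval (partial_deriv k (F $ j)) (a + t i *s (b - a)) * (b - a) $ k))"
      by (rule sum.swap)
    also have "\<dots> = (node_matrix F N lam t a b *v (b - a)) $ j"
      by (simp only: matrix_vector_mult_def node_matrix_entry sum_distrib_right vec_lambda_beta mult.assoc)
    finally show ?thesis .
  qed
  moreover have "(L *s (polymap_fun F b - polymap_fun F a)) $ j = L * (poly_eval (F $ j) b - poly_eval (F $ j) a)"
    by (simp add: polymap_fun_def right_diff_distrib)
  ultimately show "(node_matrix F N lam t a b *v (b - a)) $ j = (L *s (polymap_fun F b - polymap_fun F a)) $ j"
    by simp
qed

lemma full_column_rank_injective: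
  fixes A :: "'a::field^'n^'m"
  assumes "rank A = CARD('n)" "A *v x = 0"
  shows "x = 0"
proof -
  have "vec.span (rows A) = UNIV"
    using assms(1) unfolding row_rank_def_gen
    by (simp add: vec.dim_eq_full[symmetric] card_cart_basis vec.dimension_def)
  thus ?thesis using assms(2)
    by (metis matrix_left_invertible_span_rows_gen matrix_left_invertible_ker)
qed

section \<open>Separable functions and determinants\<close>

text \<open>The image of the tensor product of the polynomial functions of \<open>x\<close> and all functions of \<open>y\<close>. The
functions of \<open>y\<close> only supply scalars, as \<open>y\<close> is held fixed when such an expansion is used.\<close>

definition separable :: "(complex^'n::finite \<Rightarrow> complex^'n \<Rightarrow> complex) \<Rightarrow> bool" where
  "separable h \<longleftrightarrow> (\<exists>S g. finite (S :: 'n polyfun set) \<and> (\<forall>x y. h x y = (\<Sum>f\<in>S. ev f x * g f y)))"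

lemma separable_fst: "separable (\<lambda>x y. ev f x)"
  unfolding separable_def by (intro exI[of _ "{f}"] exI[of _ "\<lambda>_ _. 1"]) simp

lemma separable_snd: "separable (\<lambda>x y. g y)"
  unfolding separable_def by (intro exI[of _ "{1}"] exI[of _ "\<lambda>_. g"]) simp

text \<open>Several separable functions can be expanded over one common finite set of functions of \<open>x\<close>.\<close>

lemma separable_superset:
  assumes "separable h"
  shows "\<exists>S. finite S \<and> (\<forall>T. finite T \<longrightarrow> S \<subseteq> T \<longrightarrow> (\<exists>g. \<forall>x y. h x y = (\<Sum>f\<in>T. ev f x * g f y)))"
proof -
  obtain S g where S: "finite S" "\<And>x y. h x y = (\<Sum>f\<in>S. ev f x * g f y)"
    using assms unfolding separable_def by blast
  have "\<exists>g. \<forall>x y. h x y = (\<Sum>f\<in>T. ev f x * g f y)" if "finite T" "S \<subseteq> T" for T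
  proof (rule exI, intro allI)
    fix x y
    show "h x y = (\<Sum>f\<in>T. ev f x * (\<lambda>f y. if f \<in> S then g f y else 0) f y)"
      using that unfolding S(2) by (intro sum.mono_neutral_cong_left) auto
  qed
  thus ?thesis using S(1) by blast
qed

lemma separable_add:
  assumes "separable h" "separable k"
  shows "separable (\<lambda>x y. h x y + k x y)"
proof -
  obtain S where S: "finite S" "\<And>T. finite T \<Longrightarrow> S \<subseteq> T \<Longrightarrow> \<exists>g. \<forall>x y. h x y = (\<Sum>f\<in>T. ev f x * g f y)"
    using separable_superset[OF assms(1)] by blast
  obtain S' where S': "finite S'" "\<And>T. finite T \<Longrightarrow> S' \<subseteq> T \<Longrightarrow> \<exists>g. \<forall>x y. k x y = (\<Sum>f\<in>T. ev f x * g f y)"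
    using separable_superset[OF assms(2)] by blast
  obtain g g' where "\<And>x y. h x y = (\<Sum>f\<in>S \<union> S'. ev f x * g f y)" "\<And>x y. k x y = (\<Sum>f\<in>S \<union> S'. ev f x * g' f y)"
    using S(2)[of "S \<union> S'"] S'(2)[of "S \<union> S'"] S(1) S'(1) by auto
  thus ?thesis unfolding separable_def using S(1) S'(1)
    by (intro exI[of _ "S \<union> S'"] exI[of _ "\<lambda>f y. g f y + g' f y"]) (simp add: sum.distrib algebra_simps)
qed

lemma separable_mult:
  assumes "separable h" "separable k"
  shows "separable (\<lambda>x y. h x y * k x y)"
proof -
  obtain S g where S: "finite S" "\<And>x y. h x y = (\<Sum>f\<in>S. ev f x * g f y)"
    using assms(1) unfolding separable_def by blast
  obtain S' g' where S': "finite S'" "\<And>x y. k x y = (\<Sum>f\<in>S'. ev f x * g' f y)"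
    using assms(2) unfolding separable_def by blast
  define m where "m = (\<lambda>(f, f'). f * f' :: 'a polyfun)"
  have "h x y * k x y = (\<Sum>f\<in>m ` (S \<times> S'). ev f x * (\<Sum>q\<in>{q \<in> S \<times> S'. m q = f}. g (fst q) y * g' (snd q) y))" for x y
  proof -
    have "h x y * k x y = (\<Sum>q\<in>S \<times> S'. ev (m q) x * (g (fst q) y * g' (snd q) y))"
      unfolding S(2) S'(2) sum_product sum.cartesian_product by (simp add: m_def case_prod_beta mult_ac)
    also have "\<dots> = (\<Sum>f\<in>m ` (S \<times> S'). \<Sum>q\<in>{q \<in> S \<times> S'. m q = f}. ev (m q) x * (g (fst q) y * g' (snd q) y))"
      using S(1) S'(1) by (intro sum.image_gen) auto
    finally show ?thesis by (simp add: sum_distrib_left)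
  qed
  thus ?thesis unfolding separable_def using S(1) S'(1)
    by (intro exI[of _ "m ` (S \<times> S')"] exI[of _ "\<lambda>f y. \<Sum>q\<in>{q \<in> S \<times> S'. m q = f}. g (fst q) y * g' (snd q) y"])
       auto
qed

lemma separable_sum: "(\<And>i. i \<in> A \<Longrightarrow> separable (h i)) \<Longrightarrow> separable (\<lambda>x y. \<Sum>i\<in>A. h i x y)"
  by (induction A rule: infinite_finite_induct) (auto intro: separable_add separable_snd[of "\<lambda>_. 0"])

lemma separable_prod: "(\<And>i. i \<in> A \<Longrightarrow> separable (h i)) \<Longrightarrow> separable (\<lambda>x y. \<Prod>i\<in>A. h i x y)"
  by (induction A rule: infinite_finite_induct) (auto intro: separable_mult separable_snd[of "\<lambda>_. 1"])

lemma separable_linear_combination: "separable (\<lambda>x y. ev f (x + t *s (y - x)))"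
proof (induction f rule: polyfun_induct)
  case (cst c)
  show ?case using separable_snd[of "\<lambda>_. c"] by simp
next
  case (coord i)
  have "separable (\<lambda>x y. ev (cst (1 - t) * coord i) x + t * y $ i)"
    by (intro separable_add separable_fst separable_snd)
  moreover have "(\<lambda>x y. ev (cst (1 - t) * coord i) x + t * y $ i) = (\<lambda>x y. ev (coord i) (x + t *s (y - x)))"
    by (simp add: fun_eq_iff algebra_simps)
  ultimately show ?case by simp
next
  case (add f g)
  thus ?case using separable_add by fastforce
next
  case (mult f g)
  thus ?case using separable_mult by fastforce
qed

lemma separable_det:
  assumes "\<And>r k. separable (\<lambda>x y. M x y $ r $ k)"
  shows "separable (\<lambda>x y. det (M x y))"
  unfolding det_def by (intro separable_sum separable_mult separable_prod assms separable_snd)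

lemma poly_det: "poly (det A) s = det (\<chi> r k. poly (A $ r $ k) s)"
  for A :: "complex poly^'n::finite^'n"
  by (simp add: det_def poly_sum poly_prod)

lemma det_nonvanishing_on_lines_constant:
  fixes M :: "complex^'n::finite \<Rightarrow> complex^'n \<Rightarrow> complex^'k::finite^'k"
  assumes nz: "\<And>x y. det (M x y) \<noteq> 0"
    and line: "\<And>r k x y u v. \<exists>P. \<forall>s. M (x + s *s u) (y + s *s v) $ r $ k = poly P s"
  shows "\<exists>c. \<forall>x y. det (M x y) = c"
proof -
  have "det (M x y) = det (M 0 0)" for x y
  proof -
    have "\<forall>r k. \<exists>P. \<forall>s. M (0 + s *s x) (0 + s *s y) $ r $ k = poly P s"
      using line by blast
    then obtain P where P: "\<And>r k s. M (0 + s *s x) (0 + s *s y) $ r $ k = poly (P r k) s"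
      by metis
    define Q where "Q = det (\<chi> r k. P r k)"
    have Q: "poly Q s = det (M (s *s x) (s *s y))" for s
    proof -
      have "poly Q s = det (\<chi> r k. poly (P r k) s)" unfolding Q_def poly_det by simp
      also have "(\<chi> r k. poly (P r k) s) = M (s *s x) (s *s y)"
        using P by (simp add: vec_eq_iff)
      finally show ?thesis .
    qed
    have "constant (poly Q)" using fundamental_theorem_of_algebra[of Q] nz Q by metis
    hence "poly Q 0 = poly Q 1" unfolding constant_def by blast
    thus ?thesis by (simp add: Q)
  qed
  thus ?thesis by blast
qed

lemma det_column_expansion:
  fixes A :: "'a::comm_ring_1^'n^'n"
  shows "det (\<chi> r k. if k = i then w $ r else A $ r $ k) =
    (\<Sum>j\<in>UNIV. w $ j * det (\<chi> r k. if k = i then (if r = j then 1 else 0) else A $ r $ k))"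
proof -
  have col: "det (\<chi> r k. if k = i then v $ r else A $ r $ k) = det (\<chi> k. if k = i then v else column k A)" for v
  proof -
    have "(\<chi> r k. if k = i then v $ r else A $ r $ k) = transpose (\<chi> k. if k = i then v else column k A)"
      by (simp add: vec_eq_iff transpose_def column_def)
    thus ?thesis by simp
  qed
  have unit: "det (\<chi> k. if k = i then axis j 1 else column k A) =
      det (\<chi> r k. if k = i then (if r = j then 1 else 0) else A $ r $ k)" for j
    unfolding col[symmetric] axis_def vec_lambda_beta by (rule refl)
  have "det (\<chi> k. if k = i then w else column k A) = det (\<chi> k. if k = i then (\<Sum>j\<in>UNIV. w $ j *s axis j 1) else column k A)"
    by (simp only: basis_expansion)
  also have "\<dots> = (\<Sum>j\<in>UNIV. det (\<chi> k. if k = i then w $ j *s axis j 1 else column k A))"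
    by (rule det_linear_row_sum) simp
  also have "\<dots> = (\<Sum>j\<in>UNIV. w $ j * det (\<chi> k. if k = i then axis j 1 else column k A))"
    by (simp only: det_row_mul)
  finally show ?thesis by (simp only: col[of w] unit)
qed

section \<open>Coordinates as rational functions of the map\<close>

definition tuple_fun :: "('n::finite \<Rightarrow> 'n polyfun) \<Rightarrow> complex^'n \<Rightarrow> complex^'n" where
  "tuple_fun F x = (\<chi> j. ev (F j) x)"

lemma tuple_fun_nth [simp]: "tuple_fun F x $ j = ev (F j) x"
  by (simp add: tuple_fun_def)

text \<open>Substitution of \<open>F\<close> is an injective ring homomorphism.\<close>

definition dominant :: "('n::finite \<Rightarrow> 'n polyfun) \<Rightarrow> bool" where
  "dominant F \<longleftrightarrow> (\<forall>a. (\<forall>x. ev a (tuple_fun F x) = 0) \<longrightarrow> a = 0)"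

lemma dominantD:
  assumes "dominant F" "\<And>x. ev a (tuple_fun F x) = 0"
  shows "a = 0"
  using assms unfolding dominant_def by simp

text \<open>Linear independence over the ring of polynomial functions of \<open>F\<close>.\<close>

definition indep_over :: "('n::finite \<Rightarrow> 'n polyfun) \<Rightarrow> 'n polyfun set \<Rightarrow> bool" where
  "indep_over F T \<longleftrightarrow> (\<forall>a. (\<forall>x. (\<Sum>f\<in>T. ev (a f) (tuple_fun F x) * ev f x) = 0) \<longrightarrow> (\<forall>f\<in>T. a f = 0))"

lemma indep_overD:
  assumes "indep_over F T" "\<And>x. (\<Sum>f\<in>T. ev (a f) (tuple_fun F x) * ev f x) = 0" "f \<in> T"
  shows "a f = 0"
  using assms unfolding indep_over_def by blast

lemma maximal_indep_over_spans:
  assumes S: "finite S" and T0: "T0 \<subseteq> S" "indep_over F T0"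
  shows "\<exists>T. T0 \<subseteq> T \<and> T \<subseteq> S \<and> indep_over F T \<and> (\<forall>f\<in>S. \<exists>b a. b \<noteq> 0 \<and>
    (\<forall>x. ev b (tuple_fun F x) * ev f x = (\<Sum>g\<in>T. ev (a g) (tuple_fun F x) * ev g x)))"
proof -
  define X where "X = {T. T0 \<subseteq> T \<and> T \<subseteq> S \<and> indep_over F T}"
  have "X \<subseteq> Pow S" by (auto simp: X_def)
  hence "finite X" using S by (meson finite_Pow_iff finite_subset)
  moreover have "T0 \<in> X" using T0 by (simp add: X_def)
  ultimately obtain T where T: "T \<in> X" and max: "\<And>T'. T' \<in> X \<Longrightarrow> T \<subseteq> T' \<Longrightarrow> T' = T"
    using finite_has_maximal[of X] by blast
  have finT: "finite T" using T S finite_subset by (auto simp: X_def)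
  have indT: "indep_over F T" using T by (simp add: X_def)
  have "\<exists>b a. b \<noteq> 0 \<and> (\<forall>x. ev b (tuple_fun F x) * ev f x = (\<Sum>g\<in>T. ev (a g) (tuple_fun F x) * ev g x))"
    if f: "f \<in> S" for f
  proof (cases "f \<in> T")
    case True
    have "(\<Sum>g\<in>T. ev (if g = f then 1 else 0) (tuple_fun F x) * ev g x) = (\<Sum>g\<in>T. if g = f then ev f x else 0)" for x
      by (intro sum.cong) auto
    hence "\<forall>x. ev 1 (tuple_fun F x) * ev f x = (\<Sum>g\<in>T. ev (if g = f then 1 else 0) (tuple_fun F x) * ev g x)"
      using True finT by simp
    thus ?thesis by (intro exI[of _ 1] exI[of _ "\<lambda>g. if g = f then 1 else 0"]) simp
  next
    case False
    have "insert f T \<notin> X" using max[of "insert f T"] False by blast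
    hence "\<not> indep_over F (insert f T)" using T f by (simp add: X_def subset_insertI2)
    then obtain a where a: "\<And>x. (\<Sum>g\<in>insert f T. ev (a g) (tuple_fun F x) * ev g x) = 0"
      and na: "\<exists>g\<in>insert f T. a g \<noteq> 0"
      unfolding indep_over_def by blast
    have eq: "ev (a f) (tuple_fun F x) * ev f x = - (\<Sum>g\<in>T. ev (a g) (tuple_fun F x) * ev g x)" for x
      using a[of x] finT False by (simp add: eq_neg_iff_add_eq_0)
    have "a f \<noteq> 0"
    proof
      assume "a f = 0"
      hence "(\<Sum>g\<in>T. ev (a g) (tuple_fun F x) * ev g x) = 0" for x
        using eq[of x] by simp
      from indep_overD[OF indT this] show False using na \<open>a f = 0\<close> by auto
    qed
    moreover have "\<forall>x. ev (a f) (tuple_fun F x) * ev f x = (\<Sum>g\<in>T. ev (- a g) (tuple_fun F x) * ev g x)"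
      using eq by (simp add: sum_negf)
    ultimately show ?thesis by (intro exI[of _ "a f"] exI[of _ "\<lambda>g. - a g"] conjI)
  qed
  hence "\<forall>f\<in>S. \<exists>b a. b \<noteq> 0 \<and> (\<forall>x. ev b (tuple_fun F x) * ev f x = (\<Sum>g\<in>T. ev (a g) (tuple_fun F x) * ev g x))"
    by (rule ballI)
  thus ?thesis using T unfolding X_def by (intro exI[of _ T]) simp
qed

lemma common_denominator:
  assumes S: "finite S" and span: "\<forall>f\<in>S. \<exists>b a. b \<noteq> 0 \<and>
    (\<forall>x. ev b (tuple_fun F x) * ev f x = (\<Sum>g\<in>T. ev (a g) (tuple_fun F x) * ev g x))"
  shows "\<exists>b A. b \<noteq> 0 \<and> (\<forall>f\<in>S. \<forall>x. ev b (tuple_fun F x) * ev f x = (\<Sum>g\<in>T. ev (A f g) (tuple_fun F x) * ev g x))"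
proof -
  from bchoice[OF span] obtain b where "\<forall>f\<in>S. \<exists>a. b f \<noteq> 0 \<and>
    (\<forall>x. ev (b f) (tuple_fun F x) * ev f x = (\<Sum>g\<in>T. ev (a g) (tuple_fun F x) * ev g x))" by blast
  from bchoice[OF this] obtain a where b: "\<And>f. f \<in> S \<Longrightarrow> b f \<noteq> 0"
    and a: "\<And>f x. f \<in> S \<Longrightarrow> ev (b f) (tuple_fun F x) * ev f x = (\<Sum>g\<in>T. ev (a f g) (tuple_fun F x) * ev g x)"
    by blast
  define A where "A f g = (\<Prod>h\<in>S - {f}. b h) * a f g" for f g
  have "ev (\<Prod>h\<in>S. b h) (tuple_fun F x) * ev f x = (\<Sum>g\<in>T. ev (A f g) (tuple_fun F x) * ev g x)"
    if f: "f \<in> S" for f x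
  proof -
    have "ev (\<Prod>h\<in>S. b h) (tuple_fun F x) * ev f x =
        ev (\<Prod>h\<in>S - {f}. b h) (tuple_fun F x) * (ev (b f) (tuple_fun F x) * ev f x)"
      using prod.remove[OF S f, of b] by simp
    also have "\<dots> = (\<Sum>g\<in>T. ev (A f g) (tuple_fun F x) * ev g x)"
      unfolding a[OF f] by (simp add: A_def sum_distrib_left mult_ac)
    finally show ?thesis .
  qed
  moreover have "(\<Prod>h\<in>S. b h) \<noteq> 0" using S b by simp
  ultimately show ?thesis
    by (intro exI[of _ "\<Prod>h\<in>S. b h"] exI[of _ A] conjI ballI allI)
qed

text \<open>Suppose that the \<open>i\<close>-th coordinate is not a rational function of \<open>F\<close>. Then 1 and this coordinate are
independent over the functions of \<open>F\<close> and extend to a maximal independent set \<open>T\<close> among the functions of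
\<open>x\<close> that occur in the \<open>N j\<close>. Multiplying the hypothesis by a common denominator \<open>b\<close> and expanding it over
\<open>T\<close>, with \<open>y\<close> fixed, gives a relation whose coefficient at the \<open>i\<close>-th coordinate must vanish. In that
coefficient every term except \<open>b\<close> has a factor \<open>F j x - F j y\<close>, so putting \<open>x = y\<close> yields \<open>b = 0\<close>.\<close>

lemma coordinate_rational_over:
  fixes F :: "'n::finite \<Rightarrow> 'n polyfun"
  assumes dom: "dominant F" and sep: "\<And>j. separable (N j)"
    and cert: "\<And>x y. x $ i - y $ i = (\<Sum>j\<in>UNIV. (ev (F j) x - ev (F j) y) * N j x y)"
  shows "\<exists>p q. q \<noteq> 0 \<and> (\<forall>x. ev q (tuple_fun F x) * x $ i = ev p (tuple_fun F x))"
proof (rule ccontr)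
  assume contr: "\<not> ?thesis"
  have ne: "(1 :: 'n polyfun) \<noteq> coord i"
  proof
    assume "(1 :: 'n polyfun) = coord i"
    hence "ev (1 :: 'n polyfun) 0 = ev (coord i) 0" by simp
    thus False by simp
  qed
  have indep0: "indep_over F {1, coord i}"
    unfolding indep_over_def
  proof (intro allI impI)
    fix a assume "\<forall>x. (\<Sum>f\<in>{1, coord i}. ev (a f) (tuple_fun F x) * ev f x) = 0"
    hence a: "ev (a 1) (tuple_fun F x) + ev (a (coord i)) (tuple_fun F x) * x $ i = 0" for x
      using ne by simp
    have "ev (a (coord i)) (tuple_fun F x) * x $ i = ev (- a 1) (tuple_fun F x)" for x
      using a[of x] by (simp add: eq_neg_iff_add_eq_0 add.commute)
    hence "\<exists>p. \<forall>x. ev (a (coord i)) (tuple_fun F x) * x $ i = ev p (tuple_fun F x)"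
      by (intro exI[of _ "- a 1"] allI)
    hence 1: "a (coord i) = 0" using contr by auto
    hence "a 1 = 0" using a by (intro dominantD[OF dom]) simp
    thus "\<forall>f\<in>{1, coord i}. a f = 0" using 1 by simp
  qed
  have "\<forall>j. \<exists>S. finite S \<and> (\<forall>T. finite T \<longrightarrow> S \<subseteq> T \<longrightarrow> (\<exists>g. \<forall>x y. N j x y = (\<Sum>f\<in>T. ev f x * g f y)))"
    using separable_superset[OF sep] by blast
  from choice[OF this] obtain SS where
    SS: "\<forall>j. finite (SS j) \<and> (\<forall>T. finite T \<longrightarrow> SS j \<subseteq> T \<longrightarrow> (\<exists>g. \<forall>x y. N j x y = (\<Sum>f\<in>T. ev f x * g f y)))"
    by (rule exE)
  define S where "S = {1, coord i} \<union> (\<Union>j. SS j)"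
  have finS: "finite S" using SS by (simp add: S_def)
  have sub: "{1, coord i} \<subseteq> S" "\<And>j. SS j \<subseteq> S" unfolding S_def by blast+
  have "\<forall>j. \<exists>g. \<forall>x y. N j x y = (\<Sum>f\<in>S. ev f x * g f y)"
    using SS finS sub(2) by simp
  from choice[OF this] obtain g where g': "\<forall>j x y. N j x y = (\<Sum>f\<in>S. ev f x * g j f y)" by (rule exE)
  hence g: "N j x y = (\<Sum>f\<in>S. ev f x * g j f y)" for j x y by simp
  from maximal_indep_over_spans[OF finS sub(1) indep0]
  obtain T where T: "{1, coord i} \<subseteq> T" "T \<subseteq> S" "indep_over F T"
    and span: "\<forall>f\<in>S. \<exists>b a. b \<noteq> 0 \<and>
    (\<forall>x. ev b (tuple_fun F x) * ev f x = (\<Sum>g\<in>T. ev (a g) (tuple_fun F x) * ev g x))"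
    by (elim exE conjE) (rule that, assumption+)
  have finT: "finite T" using T(2) finS finite_subset by blast
  from common_denominator[OF finS span] obtain b A where b: "b \<noteq> 0"
    and A: "\<And>f x. f \<in> S \<Longrightarrow> ev b (tuple_fun F x) * ev f x = (\<Sum>h\<in>T. ev (A f h) (tuple_fun F x) * ev h x)"
    by blast
  have "ev b (tuple_fun F y) = 0" for y
  proof -
    define c0 where "c0 h = (\<Sum>j\<in>UNIV. \<Sum>f\<in>S. (coord j - cst (ev (F j) y)) * cst (g j f y) * A f h)" for h
    \<comment> \<open>The coefficients of the relation over \<open>T\<close> that the multiplied hypothesis amounts to.\<close>
    define c where "c h = c0 h - (if h = coord i then b else 0) + (if h = 1 then cst (y $ i) * b else 0)" for h
    have "(\<Sum>h\<in>T. ev (c h) (tuple_fun F x) * ev h x) = 0" for x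
    proof -
      have "(\<Sum>h\<in>T. ev (c0 h) (tuple_fun F x) * ev h x) =
        (\<Sum>h\<in>T. \<Sum>j\<in>UNIV. \<Sum>f\<in>S. (ev (F j) x - ev (F j) y) * g j f y * (ev (A f h) (tuple_fun F x) * ev h x))"
        by (simp add: c0_def sum_distrib_right mult.assoc)
      also have "\<dots> = (\<Sum>j\<in>UNIV. \<Sum>h\<in>T. \<Sum>f\<in>S. (ev (F j) x - ev (F j) y) * g j f y * (ev (A f h) (tuple_fun F x) * ev h x))"
        by (rule sum.swap)
      also have "\<dots> = (\<Sum>j\<in>UNIV. \<Sum>f\<in>S. \<Sum>h\<in>T. (ev (F j) x - ev (F j) y) * g j f y * (ev (A f h) (tuple_fun F x) * ev h x))"
        by (rule sum.cong[OF refl], rule sum.swap)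
      also have "\<dots> = (\<Sum>j\<in>UNIV. \<Sum>f\<in>S. (ev (F j) x - ev (F j) y) * g j f y * (ev b (tuple_fun F x) * ev f x))"
        by (intro sum.cong refl) (simp add: A sum_distrib_left)
      also have "\<dots> = ev b (tuple_fun F x) * (\<Sum>j\<in>UNIV. (ev (F j) x - ev (F j) y) * N j x y)"
        unfolding g sum_distrib_left by (intro sum.cong refl) (simp only: mult_ac)
      also have "\<dots> = ev b (tuple_fun F x) * (x $ i - y $ i)" by (simp only: cert)
      finally have 1: "(\<Sum>h\<in>T. ev (c0 h) (tuple_fun F x) * ev h x) = ev b (tuple_fun F x) * (x $ i - y $ i)" .
      have 2: "(\<Sum>h\<in>T. ev (if h = coord i then b else 0) (tuple_fun F x) * ev h x) = ev b (tuple_fun F x) * x $ i"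
      proof -
        have "(\<Sum>h\<in>T. ev (if h = coord i then b else 0) (tuple_fun F x) * ev h x)
           = (\<Sum>h\<in>T. if h = coord i then ev b (tuple_fun F x) * x $ i else 0)"
          by (intro sum.cong) auto
        thus ?thesis using T(1) finT by simp
      qed
      have 3: "(\<Sum>h\<in>T. ev (if h = 1 then cst (y $ i) * b else 0) (tuple_fun F x) * ev h x) = y $ i * ev b (tuple_fun F x)"
      proof -
        have "(\<Sum>h\<in>T. ev (if h = 1 then cst (y $ i) * b else 0) (tuple_fun F x) * ev h x)
           = (\<Sum>h\<in>T. if h = 1 then y $ i * ev b (tuple_fun F x) else 0)"
          by (intro sum.cong) auto
        thus ?thesis using T(1) finT by simp
      qed
      have "(\<Sum>h\<in>T. ev (c h) (tuple_fun F x) * ev h x) =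
        (\<Sum>h\<in>T. ev (c0 h) (tuple_fun F x) * ev h x)
         - (\<Sum>h\<in>T. ev (if h = coord i then b else 0) (tuple_fun F x) * ev h x)
         + (\<Sum>h\<in>T. ev (if h = 1 then cst (y $ i) * b else 0) (tuple_fun F x) * ev h x)"
        by (simp only: c_def ev_simps distrib_right left_diff_distrib sum.distrib sum_subtractf)
      thus ?thesis unfolding 1 2 3 by (simp add: algebra_simps)
    qed
    hence "c (coord i) = 0" using indep_overD[OF T(3)] T(1) by blast
    hence "ev (c (coord i)) (tuple_fun F y) = 0" by simp
    moreover have "ev (c0 (coord i)) (tuple_fun F y) = 0" by (simp add: c0_def)
    ultimately show "ev b (tuple_fun F y) = 0" using ne by (simp add: c_def)
  qed
  from dominantD[OF dom this] b show False by simp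
qed

section \<open>Leading coefficients and divisibility\<close>

lemma coeff_mult_top:
  assumes "degree p \<le> m" "degree q \<le> n"
  shows "coeff (p * q) (m + n) = coeff p m * coeff q n"
proof -
  have "coeff (p * q) (m + n) = (\<Sum>i\<in>{m}. coeff p i * coeff q (m + n - i))"
    unfolding coeff_mult
  proof (rule sum.mono_neutral_right)
    show "\<forall>i\<in>{..m + n} - {m}. coeff p i * coeff q (m + n - i) = 0"
    proof
      fix i assume "i \<in> {..m + n} - {m}"
      hence "i > m \<or> m + n - i > n" by auto
      thus "coeff p i * coeff q (m + n - i) = 0" using assms by (auto simp: coeff_eq_0)
    qed
  qed auto
  thus ?thesis by simp
qed

lemma degree_and_top_coeff_prod:
  fixes f :: "'a \<Rightarrow> 'b::comm_ring_1 poly"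
  assumes "finite A" "\<And>a. a \<in> A \<Longrightarrow> degree (f a) \<le> n a"
  shows "degree (\<Prod>a\<in>A. f a) \<le> (\<Sum>a\<in>A. n a) \<and> coeff (\<Prod>a\<in>A. f a) (\<Sum>a\<in>A. n a) = (\<Prod>a\<in>A. coeff (f a) (n a))"
  using assms
proof (induction A rule: finite_induct)
  case (insert a A)
  hence IH: "degree (\<Prod>a\<in>A. f a) \<le> (\<Sum>a\<in>A. n a)" "coeff (\<Prod>a\<in>A. f a) (\<Sum>a\<in>A. n a) = (\<Prod>a\<in>A. coeff (f a) (n a))"
    and a: "degree (f a) \<le> n a" by auto
  show ?case
    using insert.hyps IH coeff_mult_top[OF a IH(1)] degree_mult_le[of "f a" "\<Prod>a\<in>A. f a"] a by simp
qed simp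

lemma degree_and_top_coeff_power:
  fixes p :: "'b::comm_ring_1 poly"
  assumes "degree p \<le> 1"
  shows "degree (p ^ n) \<le> n \<and> coeff (p ^ n) n = coeff p 1 ^ n"
  using degree_and_top_coeff_prod[of "{..<n}" "\<lambda>_. p" "\<lambda>_. 1"] assms by simp

text \<open>The leading coefficient of \<open>f (y + s *s v)\<close> in \<open>s\<close> is the value at \<open>v\<close> of the homogeneous part of \<open>f\<close> of
highest degree among those that are nonzero as functions; it does not depend on \<open>y\<close>.\<close>

lemma exists_monic_direction:
  fixes f :: "'n::finite polyfun"
  assumes "f \<noteq> 0"
  shows "\<exists>v P. lead_coeff P \<noteq> 0 \<and> (\<exists>c. lead_coeff P = cst c) \<and> (\<forall>y s. eval2 P y s = ev f (y + s *s v))"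
proof -
  obtain p where p: "\<And>x. ev f x = poly_eval p x" using ev_eq_poly_eval by blast
  define w where "w e = (\<Sum>i\<in>UNIV. Poly_Mapping.lookup e i)" for e :: "'n \<Rightarrow>\<^sub>0 nat"
  define K where "K = Poly_Mapping.keys p"
  have finK: "finite K" by (simp add: K_def)
  \<comment> \<open>The homogeneous parts.\<close>
  define H where "H j = (\<Sum>e\<in>{e\<in>K. w e = j}. cst (Poly_Mapping.lookup p e) * (\<Prod>i\<in>UNIV. coord i ^ Poly_Mapping.lookup e i))"
    for j
  define X where "X = {j\<in>w ` K. H j \<noteq> 0}"
  have finX: "finite X" using finK by (simp add: X_def)
  have "f = (\<Sum>e\<in>K. cst (Poly_Mapping.lookup p e) * (\<Prod>i\<in>UNIV. coord i ^ Poly_Mapping.lookup e i))"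
    by (rule ev_inject) (simp add: p poly_eval_def K_def)
  also have "\<dots> = (\<Sum>j\<in>w ` K. H j)" unfolding H_def by (rule sum.image_gen[OF finK])
  also have "\<dots> = (\<Sum>j\<in>X. H j)" unfolding X_def using finK by (intro sum.mono_neutral_right) auto
  finally have f: "f = (\<Sum>j\<in>X. H j)" .
  hence "X \<noteq> {}" using assms by auto
  define m where "m = Max X"
  have mX: "m \<in> X" unfolding m_def using finX \<open>X \<noteq> {}\<close> by (rule Max_in)
  have "H m \<noteq> 0" using mX by (simp add: X_def)
  then obtain v where v: "ev (H m) v \<noteq> 0" using ev_inject[of "H m" 0] by auto
  define M where "M e = smult (cst (Poly_Mapping.lookup p e)) (\<Prod>i\<in>UNIV. [:coord i, cst (v $ i):] ^ Poly_Mapping.lookup e i)" for e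
  have M: "degree (M e) \<le> w e"
    "coeff (M e) (w e) = cst (Poly_Mapping.lookup p e * (\<Prod>i\<in>UNIV. v $ i ^ Poly_Mapping.lookup e i))" for e
  proof -
    have 1: "degree ([:coord i, cst (v $ i):] ^ n) \<le> n \<and> coeff ([:coord i, cst (v $ i):] ^ n) n = cst (v $ i) ^ n" for i n
      using degree_and_top_coeff_power[of "[:coord i, cst (v $ i):]" n] by simp
    have 2: "degree (\<Prod>i\<in>UNIV. [:coord i, cst (v $ i):] ^ Poly_Mapping.lookup e i) \<le> w e \<and>
      coeff (\<Prod>i\<in>UNIV. [:coord i, cst (v $ i):] ^ Poly_Mapping.lookup e i) (w e) = (\<Prod>i\<in>UNIV. cst (v $ i) ^ Poly_Mapping.lookup e i)"
      unfolding w_def using degree_and_top_coeff_prod[of UNIV "\<lambda>i. [:coord i, cst (v $ i):] ^ Poly_Mapping.lookup e i" "Poly_Mapping.lookup e"] 1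
      by simp
    show "degree (M e) \<le> w e" unfolding M_def using 2 degree_smult_le order_trans by blast
    have "coeff (M e) (w e) = cst (Poly_Mapping.lookup p e) * (\<Prod>i\<in>UNIV. cst (v $ i) ^ Poly_Mapping.lookup e i)"
      unfolding M_def using 2 by simp
    also have "\<dots> = cst (Poly_Mapping.lookup p e * (\<Prod>i\<in>UNIV. v $ i ^ Poly_Mapping.lookup e i))"
      by (rule ev_inject) simp
    finally show "coeff (M e) (w e) = cst (Poly_Mapping.lookup p e * (\<Prod>i\<in>UNIV. v $ i ^ Poly_Mapping.lookup e i))" .
  qed
  have evM: "eval2 (M e) y s = Poly_Mapping.lookup p e * (\<Prod>i\<in>UNIV. (y + s *s v) $ i ^ Poly_Mapping.lookup e i)" for e y s
    by (simp add: M_def eval2_def poly_prod poly_power)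
  define P where "P = (\<Sum>j\<in>X. \<Sum>e\<in>{e\<in>K. w e = j}. M e)"
  have evP: "eval2 P y s = ev f (y + s *s v)" for y s
  proof -
    have "eval2 P y s = (\<Sum>j\<in>X. \<Sum>e\<in>{e\<in>K. w e = j}. eval2 (M e) y s)"
      by (simp add: P_def eval2_def poly_sum)
    also have "\<dots> = ev f (y + s *s v)" unfolding f by (simp add: H_def evM)
    finally show ?thesis .
  qed
  have degP: "degree P \<le> m" unfolding P_def
  proof (rule degree_sum_le[OF finX])
    fix j assume j: "j \<in> X"
    show "degree (\<Sum>e\<in>{e\<in>K. w e = j}. M e) \<le> m"
    proof (rule degree_sum_le)
      fix e assume "e \<in> {e\<in>K. w e = j}"
      hence "degree (M e) \<le> j" using M(1)[of e] by simp
      also have "j \<le> m" unfolding m_def using finX j by simp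
      finally show "degree (M e) \<le> m" .
    qed (use finK in auto)
  qed
  have "coeff P m = (\<Sum>j\<in>X. \<Sum>e\<in>{e\<in>K. w e = j}. coeff (M e) m)" by (simp add: P_def coeff_sum)
  also have "\<dots> = (\<Sum>j\<in>{m}. \<Sum>e\<in>{e\<in>K. w e = j}. coeff (M e) m)"
  proof (rule sum.mono_neutral_right[OF finX])
    show "\<forall>j\<in>X - {m}. (\<Sum>e\<in>{e\<in>K. w e = j}. coeff (M e) m) = 0"
    proof
      fix j assume j: "j \<in> X - {m}"
      hence "j \<le> m" unfolding m_def using finX by (intro Max_ge) auto
      hence "j < m" using j by simp
      hence "coeff (M e) m = 0" if "w e = j" for e
        using M(1)[of e] that by (intro coeff_eq_0) simp
      thus "(\<Sum>e\<in>{e\<in>K. w e = j}. coeff (M e) m) = 0" by simp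
    qed
  qed (use mX in auto)
  also have "\<dots> = cst (ev (H m) v)"
    by (rule ev_inject) (simp add: H_def, rule sum.cong, use M(2) in auto)
  finally have cP: "coeff P m = cst (ev (H m) v)" .
  hence "degree P = m" using degP v by (intro antisym le_degree) simp_all
  thus ?thesis using cP v evP by (intro exI[of _ v] exI[of _ P]) auto
qed

lemma monic_division:
  fixes f g :: "'a::idom poly"
  assumes "lead_coeff g = 1"
  shows "\<exists>q r. f = g * q + r \<and> (r = 0 \<or> degree r < degree g)"
proof -
  have g: "g \<noteq> 0" using assms by auto
  obtain q r where qr: "pseudo_divmod f g = (q, r)" by force
  show ?thesis using pseudo_divmod[OF g qr] assms by auto
qed

text \<open>The remainder of \<open>p\<close> on division by \<open>k\<close> becomes a multiple of \<open>k\<close> after scaling, but its degree is too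
small.\<close>

lemma monic_dvd_cancel_scalar:
  fixes k p w :: "'a::idom poly"
  assumes monic: "lead_coeff k = 1" and a: "a \<noteq> 0" and eq: "smult a p = k * w"
  shows "k dvd p"
proof -
  obtain q r where qr: "p = k * q + r" "r = 0 \<or> degree r < degree k"
    using monic_division[OF monic] by blast
  have *: "smult a r = k * (w - smult a q)"
    using eq unfolding qr(1) by (simp add: smult_add_right algebra_simps)
  have "r = 0"
  proof (rule ccontr)
    assume r: "r \<noteq> 0"
    hence "w - smult a q \<noteq> 0" using * a by auto
    moreover have "k \<noteq> 0" using monic by auto
    ultimately have "degree (smult a r) \<ge> degree k" unfolding * by (simp add: degree_mult_eq)
    thus False using qr(2) r a by simp
  qed
  thus ?thesis using qr by simp
qed

text \<open>By Gauss's lemma the contents of \<open>d\<close> and \<open>k\<close> multiply to \<open>a\<close>, up to a unit, since \<open>q\<close> is primitive; so do their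
leading coefficients. As each content divides the leading coefficient, they agree up to a unit.\<close>

lemma lead_coeff_dvd_coeff_of_monic_multiple:
  fixes q d k :: "complex poly poly"
  assumes monic: "lead_coeff q = 1" and a: "a \<noteq> 0" and eq: "smult a q = d * k"
  shows "lead_coeff d dvd coeff d j"
proof -
  have "content q dvd 1" using content_dvd_coeff[of q "degree q"] monic by simp
  hence "content q = 1" using is_unit_normalize[of "content q"] by simp
  hence norm: "normalize a = content d * content k"
    using arg_cong[OF eq, of content] by (simp add: content_mult)
  have "lead_coeff (smult a q) = a" using monic by simp
  hence al: "a = lead_coeff d * lead_coeff k" unfolding eq by (simp add: lead_coeff_mult)
  obtain x where x: "lead_coeff d = content d * x" using content_dvd_coeff[of d "degree d"] by (elim dvdE)
  obtain y where y: "lead_coeff k = content k * y" using content_dvd_coeff[of k "degree k"] by (elim dvdE)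
  have "a = normalize a * (x * y)" unfolding norm by (subst al) (simp add: x y)
  moreover have "a dvd normalize a" by simp
  then obtain u where "normalize a = a * u" by (rule dvdE)
  ultimately have "a * (u * (x * y)) = a * 1" by (simp add: mult.assoc)
  hence "u * (x * y) = 1" using a by (simp only: mult_cancel_left) simp
  hence "x dvd 1" by (metis dvd_triv_left dvd_mult mult.commute)
  hence "lead_coeff d dvd content d" unfolding x by (simp add: mult_unit_dvd_iff)
  thus ?thesis using content_dvd_coeff dvd_trans by blast
qed

definition restrict_line :: "complex^'n::finite \<Rightarrow> complex^'n \<Rightarrow> 'n polyfun \<Rightarrow> complex poly" where
  "restrict_line y v f = (SOME P. \<forall>s. poly P s = ev f (y + s *s v))"

lemma poly_restrict_line: "poly (restrict_line y v f) s = ev f (y + s *s v)"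
proof -
  have "\<exists>P. \<forall>s. poly P s = ev f (y + s *s v)" using ev_line[of f y v] by (auto simp: eq_commute)
  from someI_ex[OF this] show ?thesis by (simp add: restrict_line_def)
qed

lemma restrict_line_hom:
  "restrict_line y v 0 = 0" "restrict_line y v 1 = 1"
  "restrict_line y v (f + g) = restrict_line y v f + restrict_line y v g"
  "restrict_line y v (f * g) = restrict_line y v f * restrict_line y v g"
  by (simp_all add: poly_restrict_line flip: poly_eq_poly_eq_iff add: fun_eq_iff)

lemma map_poly_mult_hom:
  fixes h :: "'a::comm_ring_1 \<Rightarrow> 'b::comm_ring_1"
  assumes h: "h 0 = 0" "\<And>x y. h (x + y) = h x + h y" "\<And>x y. h (x * y) = h x * h y"
  shows "map_poly h (p * q) = map_poly h p * map_poly h q"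
proof (rule poly_eqI)
  fix n
  have "h (sum f A) = (\<Sum>a\<in>A. h (f a))" for f and A :: "nat set"
    by (induction A rule: infinite_finite_induct) (auto simp: h)
  thus "coeff (map_poly h (p * q)) n = coeff (map_poly h p * map_poly h q) n"
    by (simp add: coeff_map_poly h coeff_mult)
qed

lemma lead_coeff_dvd_coeff_on_line:
  fixes q d k :: "'n::finite polyfun poly"
  assumes monic: "lead_coeff q = 1" and eq: "smult a q = d * k" and a: "ev a y \<noteq> 0"
  shows "restrict_line y v (lead_coeff d) dvd restrict_line y v (coeff d j)"
proof -
  define L where "L = map_poly (restrict_line y v)"
  have coL: "coeff (L p) n = restrict_line y v (coeff p n)" for p n
    by (simp add: L_def coeff_map_poly restrict_line_hom)
  have degL: "degree (L p) \<le> degree p" for p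
    by (rule degree_le) (simp add: coL coeff_eq_0 restrict_line_hom)
  have lead: "lead_coeff (L p) = restrict_line y v (lead_coeff p)" if "restrict_line y v (lead_coeff p) \<noteq> 0" for p
  proof -
    have "degree p \<le> degree (L p)" using that by (intro le_degree) (simp add: coL)
    hence "degree (L p) = degree p" using degL[of p] by simp
    thus ?thesis by (simp add: coL)
  qed
  have a0: "restrict_line y v a \<noteq> 0"
  proof
    assume "restrict_line y v a = 0"
    hence "poly (restrict_line y v a) 0 = 0" by simp
    thus False using a by (simp add: poly_restrict_line)
  qed
  have "smult (restrict_line y v a) (L q) = L d * L k"
  proof -
    have "smult (restrict_line y v a) (L q) = L (smult a q)"
      by (rule poly_eqI) (simp add: coL restrict_line_hom)
    thus ?thesis unfolding eq unfolding L_def by (simp add: map_poly_mult_hom restrict_line_hom)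
  qed
  moreover have "lead_coeff (L q) = 1"
    using lead[of q] monic by (simp add: restrict_line_hom)
  ultimately have dvd: "lead_coeff (L d) dvd coeff (L d) j"
    using lead_coeff_dvd_coeff_of_monic_multiple a0 by blast
  have "restrict_line y v (lead_coeff d) \<noteq> 0"
  proof
    assume 0: "restrict_line y v (lead_coeff d) = 0"
    have "a = lead_coeff d * lead_coeff k"
      using arg_cong[OF eq, of lead_coeff] monic a by (cases "a = 0") (simp_all add: lead_coeff_mult)
    thus False using a0 0 by (simp add: restrict_line_hom)
  qed
  from lead[OF this] dvd show ?thesis by (simp only: coL)
qed

text \<open>Divisibility can be tested on lines, where it is a statement about polynomials in one variable. In a
direction in which the leading coefficient \<open>c\<close> of \<open>d\<close> is monic, up to a scalar, division with remainder
works over the polynomial functions, and the remainder vanishes on each line through a point where \<open>a\<close>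
does not vanish, hence everywhere.\<close>

lemma lead_coeff_dvd_coeff_polyfun:
  fixes q d k :: "'n::finite polyfun poly"
  assumes monic: "lead_coeff q = 1" and a: "a \<noteq> 0" and eq: "smult a q = d * k"
  shows "lead_coeff d dvd coeff d j"
proof -
  define c where "c = lead_coeff d"
  have "c \<noteq> 0" using a eq monic by (auto simp: c_def)
  then obtain v P c0 where P: "lead_coeff P \<noteq> 0" "lead_coeff P = cst c0" "\<And>y s. eval2 P y s = ev c (y + s *s v)"
    using exists_monic_direction by blast
  have c0: "c0 \<noteq> 0" using P by auto
  define P' where "P' = smult (cst (1 / c0)) P"
  have "lead_coeff P' = cst (1 / c0) * cst c0" by (simp add: P'_def P)
  also have "\<dots> = 1" using c0 by (intro ev_inject) simp
  finally have monP: "lead_coeff P' = 1" .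
  obtain Q where Q: "\<And>y s. eval2 Q y s = ev (coeff d j) (y + s *s v)"
  proof -
    obtain W where W: "\<forall>x s. eval2 W x s = ev (coeff d j) (\<chi> k. eval2 [:coord k, cst (v $ k):] x s)"
      using eval2_substitute[of "coeff d j" "\<lambda>k. [:coord k, cst (v $ k):]"] by blast
    have "(\<chi> k. eval2 [:coord k, cst (v $ k):] x s) = x + s *s v" for x s
      by (simp add: vec_eq_iff)
    thus ?thesis using W by (intro that[of W]) simp
  qed
  obtain g r where gr: "Q = P' * g + r" "r = 0 \<or> degree r < degree P'" using monic_division[OF monP] by blast
  have "at_point y r = 0" if y: "ev a y \<noteq> 0" for y
  proof (rule ccontr)
    assume r0: "at_point y r \<noteq> 0"
    hence r: "degree r < degree P'" using gr(2) by (auto simp: at_point_def)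
    obtain z where z: "restrict_line y v (coeff d j) = restrict_line y v c * z"
      using lead_coeff_dvd_coeff_on_line[OF monic eq y, of v j] unfolding c_def by (elim dvdE)
    have "at_point y r = at_point y P' * ([:c0:] * z - at_point y g)"
    proof (rule poly_eq_poly_eq_iff[THEN iffD1], rule ext)
      fix s
      have "poly (at_point y r) s = eval2 Q y s - eval2 P' y s * eval2 g y s"
        by (simp add: poly_at_point gr(1))
      also have "eval2 Q y s = ev c (y + s *s v) * poly z s"
        using arg_cong[OF z, of "\<lambda>p. poly p s"] by (simp add: Q poly_restrict_line)
      also have "ev c (y + s *s v) = c0 * eval2 P' y s" using c0 by (simp add: P'_def P(3))
      finally show "poly (at_point y r) s = poly (at_point y P' * ([:c0:] * z - at_point y g)) s"
        by (simp add: poly_at_point algebra_simps)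
    qed
    moreover from this have "[:c0:] * z - at_point y g \<noteq> 0" using r0 by auto
    moreover have "degree (at_point y P') = degree P'"
    proof (rule antisym[OF degree_at_point_le le_degree])
      show "coeff (at_point y P') (degree P') \<noteq> 0" using monP by simp
    qed
    moreover have "at_point y P' \<noteq> 0" using r \<open>degree (at_point y P') = degree P'\<close> by auto
    ultimately have "degree (at_point y r) \<ge> degree P'" by (simp add: degree_mult_eq)
    thus False using r degree_at_point_le[of y r] by simp
  qed
  hence "ev (a * coeff r n) y = 0" for n y
    by (cases "ev a y = 0") (auto simp flip: coeff_at_point)
  hence "a * coeff r n = 0" for n by (intro ev_inject) simp
  hence "r = 0" using a by (intro poly_eqI) simp
  hence "ev (coeff d j) y = ev (c * (cst (1 / c0) * coeff g 0)) y" for y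
    using Q[of y 0] P(3)[of y 0] unfolding gr(1) P'_def
    by (simp add: eval2_def poly_0_coeff_0 coeff_mult)
  hence "coeff d j = c * (cst (1 / c0) * coeff g 0)" by (rule ev_inject)
  thus ?thesis unfolding c_def by (rule dvdI)
qed

text \<open>The absolute value at \<open>s\<close> is the product of the distances from \<open>s\<close> to the roots, hence at least a power
of the smallest distance.\<close>

lemma monic_root_near:
  fixes P :: "complex poly"
  assumes "lead_coeff P = 1" "degree P = Suc n"
  shows "\<exists>r. poly P r = 0 \<and> norm (s - r) ^ Suc n \<le> norm (poly P s)"
  using assms
proof (induction n arbitrary: P)
  case (0 P)
  obtain r where r: "poly P r = 0"
    using fundamental_theorem_of_algebra[of P] 0 constant_degree[of P] by auto
  then obtain Q where Q: "P = [:-r, 1:] * Q" by (metis poly_eq_0_iff_dvd dvdE)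
  have "Q \<noteq> 0" using 0 Q by auto
  hence "degree Q = 0" using 0(2) unfolding Q by (subst (asm) degree_mult_eq) auto
  moreover have "lead_coeff Q = 1" using 0(1) unfolding Q by (simp only: lead_coeff_mult) simp
  ultimately have "Q = 1" by (metis degree_0_id lead_coeff_pCons(1) one_pCons degree_eq_zeroE coeff_pCons_0)
  thus ?case using r Q by (intro exI[of _ r]) simp
next
  case (Suc n P)
  obtain r where r: "poly P r = 0"
    using fundamental_theorem_of_algebra[of P] Suc.prems constant_degree[of P] by auto
  then obtain Q where Q: "P = [:-r, 1:] * Q" by (metis poly_eq_0_iff_dvd dvdE)
  have "Q \<noteq> 0" using Suc.prems Q by auto
  hence "degree Q = Suc n" using Suc.prems(2) unfolding Q by (subst (asm) degree_mult_eq) auto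
  moreover have "lead_coeff Q = 1" using Suc.prems(1) unfolding Q by (simp only: lead_coeff_mult) simp
  ultimately obtain r' where r': "poly Q r' = 0" "norm (s - r') ^ Suc n \<le> norm (poly Q s)"
    using Suc.IH by blast
  have P: "norm (poly P s) = norm (s - r) * norm (poly Q s)" by (simp add: Q algebra_simps flip: norm_mult)
  show ?case
  proof (cases "norm (s - r) \<le> norm (s - r')")
    case True
    have "norm (s - r) ^ Suc (Suc n) = norm (s - r) * norm (s - r) ^ Suc n" by simp
    also have "\<dots> \<le> norm (s - r) * norm (s - r') ^ Suc n"
      using True by (intro mult_left_mono power_mono) auto
    also have "\<dots> \<le> norm (poly P s)" unfolding P using r'(2) by (intro mult_left_mono) auto
    finally show ?thesis using r by blast
  next
    case False
    have "norm (s - r') ^ Suc (Suc n) = norm (s - r') * norm (s - r') ^ Suc n" by simp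
    also have "\<dots> \<le> norm (s - r) * norm (poly Q s)"
      using False r'(2) by (intro mult_mono) auto
    finally have "norm (s - r') ^ Suc (Suc n) \<le> norm (poly P s)" unfolding P .
    moreover have "poly P r' = 0" using r'(1) Q by simp
    ultimately show ?thesis by blast
  qed
qed

section \<open>Coordinates as polynomial functions of the map\<close>

lemma norm_vector_scalar_mult: "norm (c *s x) = norm c * norm x" for x :: "complex^'n"
  by (simp add: norm_vec_def norm_mult L2_set_right_distrib)

text \<open>
The image of \<open>F\<close> is cut by the family of parallel lines \<open>s \<mapsto> y + s *s v\<close>, which singles out one variable
\<open>s\<close> while all polynomial functions remain functions on the whole space.\<close>

locale open_polymap =
  fixes F :: "'n::finite \<Rightarrow> 'n polyfun" and v :: "complex^'n"
  assumes open_range: "open (range (tuple_fun F))"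
begin

text \<open>The values of \<open>W\<close> at those pairs of a line \<open>y\<close> and a parameter \<open>s\<close> that describe the point \<open>tuple_fun F x\<close>.\<close>

definition shear :: "'n polyfun poly \<Rightarrow> complex^'n \<Rightarrow> complex \<Rightarrow> complex" where
  "shear W x s = eval2 W (tuple_fun F x - s *s v) s"

lemma shear_simps [simp]:
  "shear 0 x s = 0" "shear 1 x s = 1" "shear (A + B) x s = shear A x s + shear B x s"
  "shear (A * B) x s = shear A x s * shear B x s" "shear (A - B) x s = shear A x s - shear B x s"
  by (simp_all add: shear_def)

lemma shear_eq_eval2: "\<exists>Z. \<forall>x s. eval2 Z x s = shear W x s"
proof (induction W)
  case 0
  show ?case by (intro exI[of _ 0]) simp
next
  case (pCons f W)
  then obtain Z where Z: "\<And>x s. eval2 Z x s = shear W x s" by blast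
  obtain Y where Y: "\<And>x s. eval2 Y x s = ev f (\<chi> k. eval2 [:F k, cst (- (v $ k)):] x s)"
    using eval2_substitute[of f "\<lambda>k. [:F k, cst (- (v $ k)):]"] by blast
  have "(\<chi> k. eval2 [:F k, cst (- (v $ k)):] x s) = tuple_fun F x - s *s v" for x s
    by (simp add: vec_eq_iff)
  hence "eval2 (Y + [:0, 1:] * Z) x s = shear (pCons f W) x s" for x s
    by (simp add: Y Z shear_def)
  thus ?case by blast
qed

lemma polyfun_zero_on_shifted_range:
  assumes "\<And>x. ev f (tuple_fun F x - s *s v) = 0"
  shows "f = 0"
proof (rule polyfun_zero_on_open)
  have "open ((\<lambda>z. - (s *s v) + z) ` range (tuple_fun F))" by (rule open_translation[OF open_range])
  thus "open ((\<lambda>x. tuple_fun F x - s *s v) ` UNIV)" by (simp add: image_image)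
qed (use assms in auto)

lemma shear_inject:
  assumes "\<And>x s. shear A x s = shear B x s"
  shows "A = B"
proof -
  have "poly (A - B) (cst s) = 0" for s
    by (rule polyfun_zero_on_shifted_range[of _ s]) (use assms in \<open>simp add: shear_def eval2_def\<close>)
  hence "eval2 (A - B) y s = eval2 0 y s" for y s unfolding eval2_def by simp
  hence "A - B = 0" by (rule eval2_inject)
  thus ?thesis by simp
qed

text \<open>On the image of \<open>F\<close>, the \<open>i\<close>-th coordinate of the preimage is the quotient of \<open>l\<close> by \<open>h\<close>.\<close>

definition is_quotient :: "'n \<Rightarrow> 'n polyfun poly \<Rightarrow> 'n polyfun poly \<Rightarrow> bool" where
  "is_quotient i h l \<longleftrightarrow> (\<forall>x s. shear h x s * x $ i = shear l x s)"

lemma is_quotient_cancel: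
  assumes A: "A \<noteq> 0" and q: "is_quotient i (A * h) (A * l)"
  shows "is_quotient i h l"
proof -
  obtain ZA where ZA: "\<And>x s. eval2 ZA x s = shear A x s" using shear_eq_eval2 by blast
  obtain Zh where Zh: "\<And>x s. eval2 Zh x s = shear h x s" using shear_eq_eval2 by blast
  obtain Zl where Zl: "\<And>x s. eval2 Zl x s = shear l x s" using shear_eq_eval2 by blast
  have "eval2 (ZA * (Zh * [:coord i:] - Zl)) x s = eval2 0 x s" for x s
    using q unfolding is_quotient_def by (simp add: ZA Zh Zl algebra_simps)
  hence "ZA * (Zh * [:coord i:] - Zl) = 0" by (rule eval2_inject)
  moreover have "ZA \<noteq> 0"
  proof
    assume "ZA = 0"
    hence "shear A x s = shear 0 x s" for x s by (simp flip: ZA)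
    thus False using A shear_inject by blast
  qed
  ultimately have "Zh * [:coord i:] - Zl = 0" by simp
  hence "eval2 (Zh * [:coord i:] - Zl) x s = 0" for x s by simp
  thus ?thesis unfolding is_quotient_def by (simp add: Zh Zl mult.commute)
qed

lemma is_quotient_mult: "is_quotient i h l \<Longrightarrow> is_quotient i (A * h) (A * l)"
  by (simp add: is_quotient_def mult.assoc)

lemma is_quotient_diff: "is_quotient i h l \<Longrightarrow> is_quotient i h' l' \<Longrightarrow> is_quotient i (h - h') (l - l')"
  by (simp add: is_quotient_def left_diff_distrib)

lemma is_quotient_unique:
  assumes "is_quotient i h l" "is_quotient i h' l'"
  shows "h' * l = h * l'"
proof (rule shear_inject)
  fix x s
  have "shear l x s = shear h x s * x $ i" "shear l' x s = shear h' x s * x $ i"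
    using assms by (simp_all add: is_quotient_def)
  thus "shear (h' * l) x s = shear (h * l') x s" by simp
qed

definition denominator :: "'n \<Rightarrow> 'n polyfun poly \<Rightarrow> bool" where
  "denominator i h \<longleftrightarrow> h \<noteq> 0 \<and> (\<exists>l. is_quotient i h l)"

text \<open>A nonzero denominator \<open>d\<close> of minimal degree divides a scalar multiple of the monic denominator \<open>q0\<close>. Hence
its leading coefficient divides all its coefficients and can be cancelled, leaving a monic \<open>h\<close>. That \<open>h\<close> is
itself a denominator follows because the cofactor of \<open>h\<close> in \<open>q0\<close>, being monic, also divides \<open>p0\<close>.\<close>

lemma exists_minimal_monic_denominator:
  assumes q0: "is_quotient i q0 p0" "lead_coeff q0 = 1"
  shows "\<exists>h l. is_quotient i h l \<and> lead_coeff h = 1 \<and> (\<forall>h'. denominator i h' \<longrightarrow> degree h \<le> degree h')"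
proof -
  have "q0 \<noteq> 0" using q0(2) by auto
  hence "denominator i q0" using q0(1) by (auto simp: denominator_def)
  from ex_has_least_nat[of "denominator i", OF this, of degree]
  obtain d where d: "denominator i d" "\<And>h'. denominator i h' \<Longrightarrow> degree d \<le> degree h'" by blast
  obtain ld where ld: "is_quotient i d ld" and d0: "d \<noteq> 0" using d(1) by (auto simp: denominator_def)
  obtain a k where ak: "a \<noteq> 0" "smult a q0 = d * k + pseudo_mod q0 d" using pseudo_mod(1)[OF d0] by blast
  \<comment> \<open>The denominators, with 0, form an ideal, so the pseudo-remainder of \<open>q0\<close> by \<open>d\<close> is one of them.\<close>
  have "is_quotient i ([:a:] * q0 - k * d) ([:a:] * p0 - k * ld)"
    by (intro is_quotient_diff is_quotient_mult q0 ld)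
  moreover have "[:a:] * q0 - k * d = pseudo_mod q0 d" using ak(2) by (simp add: mult.commute)
  ultimately have "pseudo_mod q0 d \<noteq> 0 \<Longrightarrow> denominator i (pseudo_mod q0 d)" by (auto simp: denominator_def)
  hence "pseudo_mod q0 d = 0" using d(2) pseudo_mod(2)[OF d0, of q0] by force
  hence eq: "smult a q0 = d * k" using ak(2) by simp
  define c where "c = lead_coeff d"
  have c0: "c \<noteq> 0" using d0 by (simp add: c_def)
  have "[:c:] dvd d"
    unfolding const_poly_dvd_iff c_def using lead_coeff_dvd_coeff_polyfun[OF q0(2) ak(1) eq] by blast
  then obtain h where h: "d = [:c:] * h" by (elim dvdE)
  have "c * lead_coeff h = lead_coeff ([:c:] * h)" by simp
  also have "\<dots> = lead_coeff d" using arg_cong[OF h, of lead_coeff] by (rule sym)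
  also have "\<dots> = c * 1" by (simp add: c_def)
  finally have "c * lead_coeff h = c * 1" .
  hence monh: "lead_coeff h = 1" using c0 by (simp only: mult_cancel_left) simp
  have degh: "degree h = degree d" using c0 by (simp add: h)
  have "smult a q0 = h * smult c k" unfolding eq h by simp
  then obtain k' where k': "q0 = h * k'" using monic_dvd_cancel_scalar[OF monh ak(1)] by (blast elim: dvdE)
  have "lead_coeff h * lead_coeff k' = 1" using q0(2) unfolding k' lead_coeff_mult .
  hence monk: "lead_coeff k' = 1" using monh by simp
  have "d * p0 = q0 * ld" using is_quotient_unique[OF q0(1) ld] by simp
  hence "h * smult c p0 = h * (k' * ld)" unfolding k' h by (simp add: mult_ac)
  moreover have "h \<noteq> 0" using monh by auto
  ultimately have "smult c p0 = k' * ld" by (simp only: mult_cancel_left) simp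
  then obtain l where l: "p0 = k' * l" using monic_dvd_cancel_scalar[OF monk c0] by (blast elim: dvdE)
  have "k' \<noteq> 0" using monk by auto
  moreover have "is_quotient i (k' * h) (k' * l)" using q0(1) unfolding k' l by (simp only: mult.commute[of h])
  ultimately have "is_quotient i h l" by (rule is_quotient_cancel)
  moreover have "\<forall>h'. denominator i h' \<longrightarrow> degree h \<le> degree h'" unfolding degh using d(2) by simp
  ultimately show ?thesis using monh by (intro exI[of _ h] exI[of _ l] conjI)
qed

text \<open>A nonzero element \<open>m\<close> of least degree in the ideal generated by \<open>h\<close> and \<open>l\<close> divides scalar multiples of
both. Cancelling it leaves a denominator of degree \<open>degree h - degree m\<close>, so \<open>m\<close> is constant in \<open>s\<close> by
minimality.\<close>

lemma minimal_denominator_bezout: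
  assumes q: "is_quotient i h l" and h: "h \<noteq> 0" and min: "\<And>h'. denominator i h' \<Longrightarrow> degree h \<le> degree h'"
  shows "\<exists>r A B. r \<noteq> 0 \<and> [:r:] = A * h + B * l"
proof -
  define I where "I m \<longleftrightarrow> m \<noteq> 0 \<and> (\<exists>A B. m = A * h + B * l)" for m
  have "h = 1 * h + 0 * l" by simp
  hence "I h" using h unfolding I_def by blast
  from ex_has_least_nat[of I, OF this, of degree]
  obtain m where m: "I m" "\<And>m'. I m' \<Longrightarrow> degree m \<le> degree m'" by blast
  obtain A B where m0: "m \<noteq> 0" and AB: "m = A * h + B * l" using m(1) unfolding I_def by blast
  have divides: "\<exists>a k. a \<noteq> 0 \<and> smult a (C * h + D * l) = m * k" for C D
  proof -
    obtain a k where ak: "a \<noteq> 0" "smult a (C * h + D * l) = m * k + pseudo_mod (C * h + D * l) m"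
      using pseudo_mod(1)[OF m0] by blast
    have "pseudo_mod (C * h + D * l) m = ([:a:] * C - k * A) * h + ([:a:] * D - k * B) * l"
      using ak(2) unfolding AB by (simp add: algebra_simps smult_add_right)
    hence "pseudo_mod (C * h + D * l) m \<noteq> 0 \<Longrightarrow> I (pseudo_mod (C * h + D * l) m)" unfolding I_def by blast
    hence "pseudo_mod (C * h + D * l) m = 0"
      using m(2) pseudo_mod(2)[OF m0, of "C * h + D * l"] by force
    thus ?thesis using ak by auto
  qed
  obtain a k where a: "a \<noteq> 0" "smult a h = m * k" using divides[of 1 0] by auto
  obtain a' k' where a': "a' \<noteq> 0" "smult a' l = m * k'" using divides[of 0 1] by auto
  have "is_quotient i ([:a' * a:] * h) ([:a' * a:] * l)" by (rule is_quotient_mult[OF q])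
  moreover have "[:a' * a:] * h = m * smult a' k" using a(2) by (simp flip: smult_smult)
  moreover have "[:a' * a:] * l = m * smult a k'"
    using a'(2) by (simp add: mult.commute[of a' a] flip: smult_smult)
  ultimately have "is_quotient i (smult a' k) (smult a k')" by (metis is_quotient_cancel[OF m0])
  moreover have k0: "k \<noteq> 0" using a h by auto
  ultimately have "denominator i (smult a' k)" using a'(1) unfolding denominator_def by auto
  hence "degree h \<le> degree k" using min[of "smult a' k"] a'(1) by simp
  moreover have "degree h = degree m + degree k"
    using arg_cong[OF a(2), of degree] a(1) m0 k0 by (simp add: degree_mult_eq)
  ultimately have "degree m = 0" by simp
  then obtain r where "m = [:r:]" by (metis degree_eq_zeroE)
  thus ?thesis using m0 AB by (intro exI[of _ r] exI[of _ A] exI[of _ B]) auto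
qed

text \<open>Suppose that \<open>h\<close> vanishes at a point of the image. The roots of the monic \<open>h\<close> vary continuously with the
line and the image is open, so on each nearby line \<open>h\<close> vanishes at a point of the image. There \<open>l\<close>, which is
\<open>h\<close> times a coordinate, vanishes too, and with it \<open>r\<close>. Thus \<open>r\<close> vanishes on an open set of lines.\<close>

lemma minimal_denominator_nonvanishing:
  assumes q: "is_quotient i h l" and monic: "lead_coeff h = 1" and r: "r \<noteq> 0" "[:r:] = A * h + B * l"
  shows "shear h x s \<noteq> 0"
proof
  assume z: "shear h x s = 0"
  define y0 where "y0 = tuple_fun F x - s *s v"
  have z0: "eval2 h y0 s = 0" using z by (simp add: shear_def y0_def)
  have deg: "degree (at_point y h) = degree h" "lead_coeff (at_point y h) = 1" for y
  proof -
    show *: "degree (at_point y h) = degree h"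
    proof (rule antisym[OF degree_at_point_le le_degree])
      show "coeff (at_point y h) (degree h) \<noteq> 0" using monic by simp
    qed
    show "lead_coeff (at_point y h) = 1" unfolding * using monic by simp
  qed
  have "degree h \<noteq> 0"
  proof
    assume "degree h = 0"
    then obtain a where "h = [:a:]" by (metis degree_eq_zeroE)
    hence "h = 1" using monic by (simp add: one_pCons)
    thus False using z by simp
  qed
  then obtain n where n: "degree h = Suc n" using not0_implies_Suc by blast
  obtain e where e: "e > 0" "ball (tuple_fun F x) e \<subseteq> range (tuple_fun F)"
    using open_range by (meson openE rangeI)
  \<comment> \<open>A displacement below \<open>d\<close> along a line moves points by less than \<open>e / 2\<close>.\<close>
  define d where "d = e / (2 * (1 + norm v))"
  have v1: "1 + norm v > 0" using norm_ge_zero[of v] by linarith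
  have d: "d > 0" "d * norm v < e / 2"
  proof -
    show "d > 0" using e v1 by (simp add: d_def)
    hence "d * norm v < d * (1 + norm v)" by simp
    also have "\<dots> = e / 2" using v1 by (simp add: d_def field_simps)
    finally show "d * norm v < e / 2" .
  qed
  have "continuous_on UNIV (\<lambda>y. eval2 h y s)" unfolding eval2_def by (rule continuous_on_ev)
  hence "open ((\<lambda>y. eval2 h y s) -` ball 0 (d ^ Suc n))" by (simp add: continuous_on_open_vimage)
  hence opS: "open ((\<lambda>y. eval2 h y s) -` ball 0 (d ^ Suc n) \<inter> ball y0 (e / 2))" by auto
  have "y0 \<in> (\<lambda>y. eval2 h y s) -` ball 0 (d ^ Suc n) \<inter> ball y0 (e / 2)" using z0 e d by simp
  hence neS: "(\<lambda>y. eval2 h y s) -` ball 0 (d ^ Suc n) \<inter> ball y0 (e / 2) \<noteq> {}" by blast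
  have "r = 0"
  proof (rule polyfun_zero_on_open[OF opS neS])
    fix y assume y: "y \<in> (\<lambda>y. eval2 h y s) -` ball 0 (d ^ Suc n) \<inter> ball y0 (e / 2)"
    obtain \<rho> where \<rho>: "eval2 h y \<rho> = 0" "norm (s - \<rho>) ^ Suc n \<le> norm (eval2 h y s)"
      using monic_root_near[of "at_point y h" n s] deg n by (auto simp: poly_at_point)
    have "norm (s - \<rho>) ^ Suc n < d ^ Suc n" using \<rho>(2) y by simp
    hence close: "norm (s - \<rho>) < d" using d(1) by (meson less_imp_le power_less_imp_less_base)
    have "tuple_fun F x - (y + \<rho> *s v) = (y0 - y) + (s - \<rho>) *s v"
      by (simp add: y0_def vec_eq_iff algebra_simps)
    hence "dist (tuple_fun F x) (y + \<rho> *s v) \<le> norm (y0 - y) + norm (s - \<rho>) * norm v"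
      unfolding dist_norm by (metis norm_triangle_ineq norm_vector_scalar_mult)
    also have "\<dots> \<le> norm (y0 - y) + d * norm v" using close by (intro add_left_mono mult_right_mono) auto
    also have "\<dots> < e" using d(2) y by (simp add: dist_norm)
    finally have "y + \<rho> *s v \<in> range (tuple_fun F)" using e(2) by auto
    then obtain x' where x': "y + \<rho> *s v = tuple_fun F x'" by blast
    have y': "tuple_fun F x' - \<rho> *s v = y" by (simp flip: x')
    have "shear h x' \<rho> = 0" using \<rho>(1) by (simp add: shear_def y')
    moreover from this have "shear l x' \<rho> = 0" using q unfolding is_quotient_def by (metis mult_zero_left)
    ultimately have "shear [:r:] x' \<rho> = 0" unfolding r(2) by simp
    thus "ev r y = 0" by (simp add: shear_def y')
  qed
  thus False using r(1) by simp
qed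

text \<open>For fixed \<open>s\<close>, the function \<open>h\<close> composed with \<open>F\<close> is a polynomial function without zeros, hence constant, and
so \<open>h\<close> does not depend on \<open>y\<close>. As a polynomial in \<open>s\<close> alone it has no zeros either.\<close>

lemma monic_nonvanishing_shear_trivial:
  assumes monic: "lead_coeff h = 1" and nz: "\<And>x s. shear h x s \<noteq> 0"
  shows "h = 1"
proof -
  obtain Z where Z: "\<And>x s. eval2 Z x s = shear h x s" using shear_eq_eval2 by blast
  have const: "\<exists>c. poly h (cst s) = cst c" for s
  proof -
    have "ev (poly Z (cst s)) x \<noteq> 0" for x using nz Z by (simp flip: eval2_def)
    then obtain c where c: "poly Z (cst s) = cst c" using nonvanishing_polyfun_constant by blast
    have "poly h (cst s) - cst c = 0"
    proof (rule polyfun_zero_on_shifted_range[of _ s])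
      fix x
      have "ev (poly h (cst s)) (tuple_fun F x - s *s v) = eval2 Z x s"
        using Z[of x s] by (simp add: shear_def eval2_def)
      thus "ev (poly h (cst s) - cst c) (tuple_fun F x - s *s v) = 0" by (simp add: eval2_def c)
    qed
    thus ?thesis by auto
  qed
  have "poly (at_point 0 h) s \<noteq> 0" for s
  proof -
    obtain c where c: "poly h (cst s) = cst c" using const by blast
    have "poly (at_point 0 h) s = shear h 0 s" by (simp add: poly_at_point shear_def eval2_def c)
    thus ?thesis using nz by simp
  qed
  hence "degree (at_point 0 h) = 0"
    using fundamental_theorem_of_algebra[of "at_point 0 h"] constant_degree[of "at_point 0 h"] by blast
  moreover have "degree h \<le> degree (at_point 0 h)" by (rule le_degree) (use monic in simp)
  ultimately have "degree h = 0" by simp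
  then obtain a where "h = [:a:]" by (metis degree_eq_zeroE)
  thus "h = 1" using monic by (simp add: one_pCons)
qed

end

text \<open>
A denominator of the coordinate becomes monic in \<open>s\<close> for a suitable direction \<open>v\<close> of lines. Reduced to
lowest terms it has no zero on the image of \<open>F\<close>, and this forces it to be 1.\<close>

lemma rational_coordinate_is_polynomial:
  fixes F :: "'n::finite \<Rightarrow> 'n polyfun"
  assumes opn: "open (range (tuple_fun F))" and q: "q \<noteq> 0"
    and eq: "\<And>x. ev q (tuple_fun F x) * x $ i = ev p (tuple_fun F x)"
  shows "\<exists>g. \<forall>x. x $ i = ev g (tuple_fun F x)"
proof -
  obtain v P c where P: "lead_coeff P \<noteq> 0" "lead_coeff P = cst c" "\<And>y s. eval2 P y s = ev q (y + s *s v)"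
    using exists_monic_direction[OF q] by blast
  have c: "c \<noteq> 0" using P by auto
  interpret open_polymap F v by unfold_locales (rule opn)
  obtain R where R: "\<And>y s. eval2 R y s = ev p (\<chi> k. eval2 [:coord k, cst (v $ k):] y s)"
    using eval2_substitute[of p "\<lambda>k. [:coord k, cst (v $ k):]"] by blast
  have vec: "(\<chi> k. eval2 [:coord k, cst (v $ k):] y s) = y + s *s v" for y s by (simp add: vec_eq_iff)
  have R': "eval2 R y s = ev p (y + s *s v)" for y s by (simp only: R vec)
  define q0 where "q0 = smult (cst (1 / c)) P"
  define p0 where "p0 = smult (cst (1 / c)) R"
  have "lead_coeff q0 = cst (1 / c) * cst c" by (simp add: q0_def P)
  also have "\<dots> = 1" using c by (intro ev_inject) simp
  finally have mon: "lead_coeff q0 = 1" .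
  have "is_quotient i q0 p0"
    unfolding is_quotient_def shear_def by (simp add: q0_def p0_def P(3) R' flip: eq)
  from exists_minimal_monic_denominator[OF this mon]
  obtain h l where h: "is_quotient i h l" "lead_coeff h = 1" "\<And>h'. denominator i h' \<Longrightarrow> degree h \<le> degree h'" by blast
  have "h \<noteq> 0" using h(2) by auto
  from minimal_denominator_bezout[OF h(1) this h(3)]
  obtain r A B where "r \<noteq> 0" "[:r:] = A * h + B * l" by blast
  from minimal_denominator_nonvanishing[OF h(1,2) this] have "h = 1"
    by (intro monic_nonvanishing_shear_trivial h(2))
  hence "x $ i = shear l x 0" for x using h(1) by (simp add: is_quotient_def)
  hence "x $ i = ev (poly l (cst 0)) (tuple_fun F x)" for x by (simp add: shear_def eval2_def)
  thus ?thesis by blast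
qed

section \<open>Injectivity and invertibility\<close>

lemma polyfun_compose:
  fixes f :: "'n::finite polyfun" and g :: "'n \<Rightarrow> 'm::finite polyfun"
  shows "\<exists>h. \<forall>z. ev h z = ev f (\<chi> k. ev (g k) z)"
proof (induction f rule: polyfun_induct)
  case (cst c)
  show ?case by (rule exI[of _ "cst c"]) simp
next
  case (coord i)
  show ?case by (rule exI[of _ "g i"]) simp
next
  case (add f1 f2)
  then obtain h1 h2 where "\<forall>z. ev h1 z = ev f1 (\<chi> k. ev (g k) z)" "\<forall>z. ev h2 z = ev f2 (\<chi> k. ev (g k) z)"
    by blast
  thus ?case by (intro exI[of _ "h1 + h2"]) simp
next
  case (mult f1 f2)
  then obtain h1 h2 where "\<forall>z. ev h1 z = ev f1 (\<chi> k. ev (g k) z)" "\<forall>z. ev h2 z = ev f2 (\<chi> k. ev (g k) z)"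
    by blast
  thus ?case by (intro exI[of _ "h1 * h2"]) simp
qed

lemma node_matrix_entry_on_line:
  "\<exists>P. \<forall>s. node_matrix F N lam t (x + s *s u) (y + s *s w) $ j $ k = poly P s"
proof (intro exI allI)
  fix s
  have line: "x + s *s u + t i *s (y + s *s w - (x + s *s u)) = (x + t i *s (y - x)) + s *s (u + t i *s (w - u))" for i
    by (simp add: vec_eq_iff algebra_simps)
  show "node_matrix F N lam t (x + s *s u) (y + s *s w) $ j $ k =
    poly (\<Sum>i=1..N. smult (lam i) (line_poly (partial_deriv k (F $ j)) (x + t i *s (y - x)) (u + t i *s (w - u)))) s"
    by (simp only: node_matrix_entry poly_sum poly_smult poly_line_poly line)
qed

lemma separable_node_matrix_entry: "separable (\<lambda>x y. node_matrix F N lam t x y $ j $ k)"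
proof -
  have "separable (\<lambda>x y. \<Sum>i=1..N. lam i * ev (polyfun_of (partial_deriv k (F $ j))) (x + t i *s (y - x)))"
    by (intro separable_sum separable_mult separable_snd separable_linear_combination)
  thus ?thesis by (simp add: node_matrix_entry)
qed

text \<open>Cramer's rule, with the determinant that contains the difference of the values of \<open>F\<close> as a column expanded
along that column.\<close>

lemma coordinate_certificate:
  fixes M :: "complex^'n::finite \<Rightarrow> complex^'n \<Rightarrow> complex^'n^'n"
  assumes det: "\<And>x y. det (M x y) = c" and c: "c \<noteq> 0"
    and diff: "\<And>x y. M x y *v (y - x) = L *s (tuple_fun F y - tuple_fun F x)"
  shows "x $ i - y $ i = (\<Sum>j\<in>UNIV. (ev (F j) x - ev (F j) y) *
    (L / c * det (\<chi> r k. if k = i then (if r = j then 1 else 0) else M x y $ r $ k)))"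
proof -
  define D where "D j = det (\<chi> r k. if k = i then (if r = j then 1 else 0) else M x y $ r $ k)" for j
  have "(y - x) $ i * c = det (\<chi> r k. if k = i then (M x y *v (y - x)) $ r else M x y $ r $ k)"
    using cramer_lemma[of i "M x y" "y - x"] by (simp only: det)
  also have "\<dots> = (\<Sum>j\<in>UNIV. (M x y *v (y - x)) $ j * D j)"
    unfolding D_def by (rule det_column_expansion)
  also have "\<dots> = (\<Sum>j\<in>UNIV. (ev (F j) y - ev (F j) x) * (L * D j))"
    unfolding diff by (simp add: algebra_simps)
  finally have E: "(y - x) $ i * c = (\<Sum>j\<in>UNIV. (ev (F j) y - ev (F j) x) * (L * D j))" .
  have "x $ i - y $ i = - ((\<Sum>j\<in>UNIV. (ev (F j) y - ev (F j) x) * (L * D j)) / c)"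
    unfolding E[symmetric] using c by simp
  also have "\<dots> = (\<Sum>j\<in>UNIV. (ev (F j) x - ev (F j) y) * (L / c * D j))"
    unfolding sum_divide_distrib sum_negf[symmetric] by (intro sum.cong refl) (simp add: divide_inverse algebra_simps)
  finally show ?thesis unfolding D_def .
qed

text \<open>The determinant of \<open>M\<close> is a polynomial without zeros and hence constant, which makes the certificate
polynomial in \<open>x\<close>. Injectivity of \<open>F\<close> gives an open image by invariance of domain, so that polynomial
identities on the image hold everywhere; in particular a polynomial left inverse is a right inverse.\<close>

lemma polynomial_left_inverse:
  fixes F :: "'n::finite \<Rightarrow> 'n polyfun" and M :: "complex^'n \<Rightarrow> complex^'n \<Rightarrow> complex^'n^'n"
  assumes diff: "\<And>x y. M x y *v (y - x) = L *s (tuple_fun F y - tuple_fun F x)"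
    and ker: "\<And>x y v. M x y *v v = 0 \<Longrightarrow> v = 0"
    and line: "\<And>r k x y u w. \<exists>P. \<forall>s. M (x + s *s u) (y + s *s w) $ r $ k = poly P s"
    and sep: "\<And>r k. separable (\<lambda>x y. M x y $ r $ k)"
  shows "\<exists>g. (\<forall>x. (\<chi> i. ev (g i) (tuple_fun F x)) = x) \<and> (\<forall>z. tuple_fun F (\<chi> i. ev (g i) z) = z)"
proof -
  have "det (M x y) \<noteq> 0" for x y
    using ker[of x y] unfolding invertible_det_nz[symmetric] invertible_left_inverse matrix_left_invertible_ker
    by blast
  then obtain c where c: "\<And>x y. det (M x y) = c" "c \<noteq> 0"
    using det_nonvanishing_on_lines_constant[of M, OF _ line] by metis
  have inj: "inj (tuple_fun F)"
  proof (rule injI)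
    fix a b assume "tuple_fun F a = tuple_fun F b"
    hence "M a b *v (b - a) = 0" unfolding diff by simp
    from ker[OF this] show "a = b" by simp
  qed
  have "continuous_on UNIV (tuple_fun F)"
    unfolding tuple_fun_def by (intro continuous_on_vec_lambda continuous_on_ev)
  hence opn: "open (range (tuple_fun F))" using inj by (intro invariance_of_domain) auto
  have vanish: "f = 0" if "\<And>x. ev f (tuple_fun F x) = 0" for f
    by (rule polyfun_zero_on_open[OF opn]) (use that in auto)
  hence dom: "dominant F" unfolding dominant_def by blast
  have "\<exists>g. \<forall>x. x $ i = ev g (tuple_fun F x)" for i
  proof -
    define N where "N j x y = L / c * det (\<chi> r k. if k = i then (if r = j then 1 else 0) else M x y $ r $ k)" for j x y
    have sepN: "separable (N j)" for j
    proof -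
      have "separable (\<lambda>x y. (\<chi> r k. if k = i then (if r = j then 1 else 0) else M x y $ r $ k) $ r $ k)" for r k
        using separable_snd[of "\<lambda>_. if r = j then 1 else 0"] sep[of r k] by (cases "k = i") auto
      hence "separable (\<lambda>x y. L / c * det (\<chi> r k. if k = i then (if r = j then 1 else 0) else M x y $ r $ k))"
        by (intro separable_mult separable_snd separable_det)
      thus ?thesis unfolding N_def .
    qed
    have "x $ i - y $ i = (\<Sum>j\<in>UNIV. (ev (F j) x - ev (F j) y) * N j x y)" for x y
      unfolding N_def by (rule coordinate_certificate[OF c diff])
    from coordinate_rational_over[OF dom sepN this]
    obtain p q where "q \<noteq> 0" "\<And>x. ev q (tuple_fun F x) * x $ i = ev p (tuple_fun F x)" by blast
    from rational_coordinate_is_polynomial[OF opn this] show ?thesis .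
  qed
  then obtain g where g: "\<And>x i. x $ i = ev (g i) (tuple_fun F x)" by metis
  hence left: "(\<chi> i. ev (g i) (tuple_fun F x)) = x" for x by (simp add: vec_eq_iff flip: g)
  have "ev (F j) (\<chi> i. ev (g i) z) = z $ j" for j z
  proof -
    obtain h where h: "\<And>z. ev h z = ev (F j) (\<chi> k. ev (g k) z)" using polyfun_compose[of "F j" g] by blast
    have "h - coord j = 0" by (rule vanish) (simp add: h left)
    hence "ev (h - coord j) z = 0" by simp
    thus ?thesis by (simp add: h)
  qed
  hence "tuple_fun F (\<chi> i. ev (g i) z) = z" for z by (simp add: vec_eq_iff)
  thus ?thesis using left by blast
qed

text \<open>A bijection between the two index types turns \<open>F\<close> into a tuple of polynomial functions in as many
variables.\<close>

lemma invertible_polymap_if_node_matrices_injective: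
  fixes F :: "('n::finite, 'm::finite) polymap"
  assumes card: "CARD('n) = CARD('m)"
    and diff: "\<And>a b. node_matrix F N lam t a b *v (b - a) = L *s (polymap_fun F b - polymap_fun F a)"
    and ker: "\<And>a b v. node_matrix F N lam t a b *v v = 0 \<Longrightarrow> v = 0"
  shows "invertible_polymap F"
proof -
  obtain p :: "'n \<Rightarrow> 'm" where p: "bij p"
    using finite_same_card_bij[of "UNIV :: 'n set" "UNIV :: 'm set"] card by auto
  have all_p: "(\<forall>j. Q j) \<longleftrightarrow> (\<forall>r. Q (p r))" for Q using p by (metis bij_pointE)
  define F' where "F' r = polyfun_of (F $ p r)" for r
  define M where "M a b = (\<chi> r. node_matrix F N lam t a b $ p r)" for a b
  have tuple: "tuple_fun F' x $ r = polymap_fun F x $ p r" for x r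
    by (simp add: F'_def polymap_fun_def)
  have Mv: "(M a b *v v) $ r = (node_matrix F N lam t a b *v v) $ p r" for a b v r
    by (simp add: M_def matrix_vector_mult_def)
  have "M a b *v (b - a) = L *s (tuple_fun F' b - tuple_fun F' a)" for a b
    unfolding vec_eq_iff Mv diff by (simp add: tuple del: tuple_fun_nth)
  moreover have "v = 0" if "M a b *v v = 0" for a b v
  proof (rule ker)
    show "node_matrix F N lam t a b *v v = 0"
      using that unfolding vec_eq_iff Mv zero_index by (subst all_p)
  qed
  moreover have "\<exists>P. \<forall>s. M (x + s *s u) (y + s *s w) $ r $ k = poly P s" for r k x y u w
    using node_matrix_entry_on_line[of F N lam t x u y w "p r" k] by (simp add: M_def)
  moreover have "separable (\<lambda>x y. M x y $ r $ k)" for r k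
    using separable_node_matrix_entry[of F N lam t "p r" k] by (simp add: M_def)
  ultimately obtain g where g: "\<And>x. (\<chi> i. ev (g i) (tuple_fun F' x)) = x"
    "\<And>z. tuple_fun F' (\<chi> i. ev (g i) z) = z"
    using polynomial_left_inverse[of M L F'] by blast
  have "\<exists>q. \<forall>y. poly_eval q y = ev (g i) (\<chi> r. y $ p r)" for i
  proof -
    obtain h where h: "\<And>y. ev h y = ev (g i) (\<chi> r. ev (coord (p r)) y)"
      using polyfun_compose[of "g i" "\<lambda>r. coord (p r)"] by blast
    moreover obtain q where "\<And>y. ev h y = poly_eval q y" using ev_eq_poly_eval by blast
    ultimately show ?thesis by (intro exI[of _ q]) simp
  qed
  then obtain q where q: "\<And>i y. poly_eval (q i) y = ev (g i) (\<chi> r. y $ p r)" by metis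
  define G :: "('m, 'n) polymap" where "G = (\<chi> i. q i)"
  have G: "polymap_fun G y = (\<chi> i. ev (g i) (\<chi> r. y $ p r))" for y
    by (simp add: polymap_fun_def G_def q)
  have tup: "tuple_fun F' x = (\<chi> r. polymap_fun F x $ p r)" for x
    by (simp add: vec_eq_iff tuple del: tuple_fun_nth)
  have "polymap_fun G (polymap_fun F x) = x" for x
    using g(1)[of x] unfolding G tup .
  moreover have "polymap_fun F (polymap_fun G y) = y" for y
    unfolding vec_eq_iff
  proof (subst all_p, intro allI)
    fix r
    have "polymap_fun F (polymap_fun G y) $ p r = tuple_fun F' (polymap_fun G y) $ r" by (simp only: tuple)
    also have "\<dots> = y $ p r" unfolding G g(2) by simp
    finally show "polymap_fun F (polymap_fun G y) $ p r = y $ p r" .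
  qed
  ultimately show ?thesis unfolding invertible_polymap_def by blast
qed

theorem corollary2p3:
  fixes F :: "('n::finite, 'm::finite) polymap"
    and d :: nat
    and lam :: "nat \<Rightarrow> complex"
  assumes "polymap_degree F = d"
    and "\<And>I. I \<subseteq> {1..d-1} \<Longrightarrow> I \<noteq> {} \<Longrightarrow> (\<Sum>i\<in>I. lam i) \<noteq> 0"
    and "\<And>\<alpha> :: nat \<Rightarrow> complex^'n.
           rank (\<Sum>i=1..d-1. smult_matrix (lam i) (eval_matrix (jacobian_matrix F) (\<alpha> i))) = CARD('n)"
  shows "inj (polymap_fun F) \<and> (CARD('n) = CARD('m) \<longrightarrow> invertible_polymap F)"
proof -
  have "subset_sums_nonzero lam {1..d-1}"
    unfolding subset_sums_nonzero_def using assms(2) by blast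
  from quadrature_nodes[OF _ this] obtain t where
    t: "\<And>P. degree P \<le> Suc (d - 1) \<Longrightarrow>
      sum lam {1..d-1} * (poly P 1 - poly P 0) = (\<Sum>i=1..d-1. lam i * poly (pderiv P) (t i))"
    by auto
  have diff: "node_matrix F (d - 1) lam t a b *v (b - a) =
      sum lam {1..d-1} *s (polymap_fun F b - polymap_fun F a)" for a b
    by (rule node_matrix_difference[OF _ t]) (use assms(1) in simp_all)
  have ker: "v = 0" if "node_matrix F (d - 1) lam t a b *v v = 0" for a b v
    using full_column_rank_injective[OF assms(3)] that unfolding node_matrix_def .
  show ?thesis
  proof (intro conjI impI injI)
    fix a b assume "polymap_fun F a = polymap_fun F b"
    hence "node_matrix F (d - 1) lam t a b *v (b - a) = 0" unfolding diff by simp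
    from ker[OF this] show "a = b" by simp
  next
    assume "CARD('n) = CARD('m)"
    then show "invertible_polymap F"
      by (rule invertible_polymap_if_node_matrices_injective[OF _ diff]) (rule ker)
  qed
qed

end
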